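(* Let $S$ be a completely regular semigroup. Then $\lambda_t=((\mathcal{D}_t)_k)_t$ is the least congruence $\rho$ on $S$ for which $\ker\nu_{S/\rho}$ is a cryptogroup.
   Context: A completely regular semigroup is a semigroup that is a union of its subgroups. A cryptogroup is a completely regular semigroup on which Green's relation $\mathcal{H}$ is a congruence. $E(S)$ is the set of idempotents of $S$. For a congruence $\rho$ on $S$: $\operatorname{tr}\rho=\rho|_{E(S)}$ and $\ker\rho=\{a\in S: a\,\rho\,e\text{ for some }e\in E(S)\}$; $\rho_t$ (resp. $\rho_k$) denotes the least congruence on $S$ with the same trace (resp. the same kernel) as $\rho$. Green's relation $\mathcal{D}$ on a completely regular semigroup is a congruence (the least semilattice congruence). A regular semigroup is orthodox if its idempotents form a subsemigroup; $\lambda$ is the least congruence on $S$ with orthodox quotient; $\lambda=(\mathcal{D}_t)_k$. A Clifford semigroup is a completely regular semigroup whose idempotents are central; for a completely regular semigroup $T$, $\nu_T$ is the least congruence on $T$ whose quotient is a Clifford semigroup, and $\ker\nu_T$ is a completely regular subsemigroup of $T$. *)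

theory Defs
  imports "HOL-Algebra.Group"
begin

record 'a magma = "'a partial_object" +
  mul :: "['a, 'a] \<Rightarrow> 'a" (infixl \<open>\<cdot>\<index>\<close> 70)

locale carrier_semigroup =
  fixes S (structure)
  assumes mul_closed [intro, simp]:
      "\<lbrakk>x \<in> carrier S; y \<in> carrier S\<rbrakk> \<Longrightarrow> x \<cdot> y \<in> carrier S"
    and mul_assoc:
      "\<lbrakk>x \<in> carrier S; y \<in> carrier S; z \<in> carrier S\<rbrakk> \<Longrightarrow> (x \<cdot> y) \<cdot> z = x \<cdot> (y \<cdot> z)"

definition idempotents :: "('a, 'm) magma_scheme \<Rightarrow> 'a set"
  where "idempotents S = {e \<in> carrier S. e \<cdot>\<^bsub>S\<^esub> e = e}"

text \<open>A subgroup of a semigroup is a subset that is a group under the restricted operation;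
  its identity element is an arbitrary idempotent, different subgroups may have different ones.\<close>

definition subgroups :: "('a, 'm) magma_scheme \<Rightarrow> 'a set set"
  where "subgroups S =
    {G. G \<subseteq> carrier S \<and> (\<exists>e. group \<lparr>carrier = G, monoid.mult = mul S, one = e\<rparr>)}"

definition completely_regular :: "('a, 'm) magma_scheme \<Rightarrow> bool"
  where "completely_regular S \<longleftrightarrow> carrier_semigroup S \<and> carrier S = \<Union> (subgroups S)"

definition regular_semigroup :: "('a, 'm) magma_scheme \<Rightarrow> bool"
  where "regular_semigroup S \<longleftrightarrow> carrier_semigroup S \<and>
    (\<forall>a\<in>carrier S. \<exists>x\<in>carrier S. a \<cdot>\<^bsub>S\<^esub> x \<cdot>\<^bsub>S\<^esub> a = a)"

definition orthodox :: "('a, 'm) magma_scheme \<Rightarrow> bool"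
  where "orthodox S \<longleftrightarrow> regular_semigroup S \<and>
    (\<forall>e\<in>idempotents S. \<forall>f\<in>idempotents S. e \<cdot>\<^bsub>S\<^esub> f \<in> idempotents S)"

definition clifford :: "('a, 'm) magma_scheme \<Rightarrow> bool"
  where "clifford S \<longleftrightarrow> completely_regular S \<and>
    (\<forall>e\<in>idempotents S. \<forall>a\<in>carrier S. e \<cdot>\<^bsub>S\<^esub> a = a \<cdot>\<^bsub>S\<^esub> e)"

text \<open>Green's relations; the principal one-sided ideals are those generated with an
  identity adjoined, that is, $S^1 a$ and $a S^1$.\<close>

definition left_ideal_of :: "('a, 'm) magma_scheme \<Rightarrow> 'a \<Rightarrow> 'a set"
  where "left_ideal_of S a = insert a {x \<cdot>\<^bsub>S\<^esub> a |x. x \<in> carrier S}"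

definition right_ideal_of :: "('a, 'm) magma_scheme \<Rightarrow> 'a \<Rightarrow> 'a set"
  where "right_ideal_of S a = insert a {a \<cdot>\<^bsub>S\<^esub> x |x. x \<in> carrier S}"

definition green_L :: "('a, 'm) magma_scheme \<Rightarrow> 'a rel"
  where "green_L S =
    {(a, b) \<in> carrier S \<times> carrier S. left_ideal_of S a = left_ideal_of S b}"

definition green_R :: "('a, 'm) magma_scheme \<Rightarrow> 'a rel"
  where "green_R S =
    {(a, b) \<in> carrier S \<times> carrier S. right_ideal_of S a = right_ideal_of S b}"

definition green_H :: "('a, 'm) magma_scheme \<Rightarrow> 'a rel"
  where "green_H S = green_L S \<inter> green_R S"

definition green_D :: "('a, 'm) magma_scheme \<Rightarrow> 'a rel"
  where "green_D S = green_L S O green_R S"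

definition congruence :: "('a, 'm) magma_scheme \<Rightarrow> 'a rel \<Rightarrow> bool"
  where "congruence S \<rho> \<longleftrightarrow> equiv (carrier S) \<rho> \<and>
    (\<forall>(a, b)\<in>\<rho>. \<forall>(c, d)\<in>\<rho>. (a \<cdot>\<^bsub>S\<^esub> c, b \<cdot>\<^bsub>S\<^esub> d) \<in> \<rho>)"

definition cryptogroup :: "('a, 'm) magma_scheme \<Rightarrow> bool"
  where "cryptogroup S \<longleftrightarrow> completely_regular S \<and> congruence S (green_H S)"

definition quotient_semigroup :: "('a, 'm) magma_scheme \<Rightarrow> 'a rel \<Rightarrow> 'a set magma"
  where "quotient_semigroup S \<rho> =
    \<lparr>carrier = carrier S // \<rho>, mul = (\<lambda>A B. \<Union>a\<in>A. \<Union>b\<in>B. \<rho> `` {a \<cdot>\<^bsub>S\<^esub> b})\<rparr>"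

lemma mul_quotient_semigroup:
  assumes "congruence S \<rho>" "a \<in> carrier S" "b \<in> carrier S"
  shows "\<rho> `` {a} \<cdot>\<^bsub>quotient_semigroup S \<rho>\<^esub> \<rho> `` {b} = \<rho> `` {a \<cdot>\<^bsub>S\<^esub> b}"
proof -
  have eq: "equiv (carrier S) \<rho>" using assms(1) by (simp add: congruence_def)
  have "\<rho> `` {x \<cdot>\<^bsub>S\<^esub> y} = \<rho> `` {a \<cdot>\<^bsub>S\<^esub> b}" if "x \<in> \<rho> `` {a}" "y \<in> \<rho> `` {b}" for x y
  proof -
    have "(a \<cdot>\<^bsub>S\<^esub> b, x \<cdot>\<^bsub>S\<^esub> y) \<in> \<rho>" using assms(1) that unfolding congruence_def by blast
    then show ?thesis using equiv_class_eq[OF eq] by blast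
  qed
  moreover have "a \<in> \<rho> `` {a}" "b \<in> \<rho> `` {b}"
    using equiv_class_self[OF eq] assms by blast+
  ultimately have "(\<Union>x\<in>\<rho> `` {a}. \<Union>y\<in>\<rho> `` {b}. \<rho> `` {x \<cdot>\<^bsub>S\<^esub> y}) = \<rho> `` {a \<cdot>\<^bsub>S\<^esub> b}"
    by blast
  then show ?thesis by (simp only: quotient_semigroup_def magma.simps)
qed

definition trace :: "('a, 'm) magma_scheme \<Rightarrow> 'a rel \<Rightarrow> 'a rel"
  where "trace S \<rho> = \<rho> \<inter> (idempotents S \<times> idempotents S)"

definition ker :: "('a, 'm) magma_scheme \<Rightarrow> 'a rel \<Rightarrow> 'a set"
  where "ker S \<rho> = {a \<in> carrier S. \<exists>e\<in>idempotents S. (a, e) \<in> \<rho>}"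

text \<open>Congruences are ordered by inclusion, so \<open>LEAST\<close> below is taken with respect to
  \<open>\<subseteq>\<close>: it is the member of the given family contained in all the others.\<close>

definition is_least_congruence ::
    "('a, 'm) magma_scheme \<Rightarrow> ('a rel \<Rightarrow> bool) \<Rightarrow> 'a rel \<Rightarrow> bool"
  where "is_least_congruence S P \<rho> \<longleftrightarrow>
    congruence S \<rho> \<and> P \<rho> \<and> (\<forall>\<sigma>. congruence S \<sigma> \<and> P \<sigma> \<longrightarrow> \<rho> \<subseteq> \<sigma>)"

definition least_congruence :: "('a, 'm) magma_scheme \<Rightarrow> ('a rel \<Rightarrow> bool) \<Rightarrow> 'a rel"
  where "least_congruence S P = (LEAST \<rho>. congruence S \<rho> \<and> P \<rho>)"

lemma least_congruence_eqI:
  "is_least_congruence S P \<rho> \<Longrightarrow> least_congruence S P = \<rho>"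
  unfolding is_least_congruence_def least_congruence_def
  by (intro Least_equality) auto

definition trace_lower :: "('a, 'm) magma_scheme \<Rightarrow> 'a rel \<Rightarrow> 'a rel"  \<comment> \<open>\<open>\<rho>\<^sub>t\<close>\<close>
  where "trace_lower S \<rho> = least_congruence S (\<lambda>\<sigma>. trace S \<sigma> = trace S \<rho>)"

definition ker_lower :: "('a, 'm) magma_scheme \<Rightarrow> 'a rel \<Rightarrow> 'a rel"  \<comment> \<open>\<open>\<rho>\<^sub>k\<close>\<close>
  where "ker_lower S \<rho> = least_congruence S (\<lambda>\<sigma>. ker S \<sigma> = ker S \<rho>)"

definition least_orthodox_congruence :: "('a, 'm) magma_scheme \<Rightarrow> 'a rel"  \<comment> \<open>\<open>\<lambda>\<close>\<close>
  where "least_orthodox_congruence S =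
    least_congruence S (\<lambda>\<sigma>. orthodox (quotient_semigroup S \<sigma>))"

definition least_clifford_congruence :: "('a, 'm) magma_scheme \<Rightarrow> 'a rel"  \<comment> \<open>\<open>\<nu>\<close>\<close>
  where "least_clifford_congruence S =
    least_congruence S (\<lambda>\<sigma>. clifford (quotient_semigroup S \<sigma>))"

definition ker_semigroup :: "('a, 'm) magma_scheme \<Rightarrow> 'a rel \<Rightarrow> ('a, 'm) magma_scheme"
  where "ker_semigroup S \<rho> = S\<lparr>carrier := ker S \<rho>\<rparr>"

end

(* Let K = ker \<lambda>. It is closed under products and under xy \<mapsto> yx, so its syntactic congruence
  identifies D-related idempotents and hence has a Clifford quotient; therefore ker \<nu> = K, and
  \<nu> = D_t gives \<lambda> = \<nu>_k. In S/\<lambda>_t the elements of K still multiply like idempotents modulo the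
  trace of \<lambda>, which has become trivial: this makes K/\<lambda>_t a cryptogroup. Conversely, if the kernel
  of \<nu> on T = S/\<rho> is a cryptogroup, it lies in the kernel of the largest idempotent-separating
  congruence of T. That congruence then has an orthodox quotient, so \<lambda> on T has trivial trace, and
  pulling back to S yields tr \<lambda> \<subseteq> \<rho>. *)

theory Submission
  imports Defs
begin

section \<open>Completely regular semigroups and Green's relations\<close>

text \<open>Inner inverses are not canonical, but the idempotent \<open>\<epsilon> a\<close> is.
  Green's R, L and H, kernels, orthodoxy of quotients and the cryptogroup condition can all be
  expressed through it, and congruences respect it. The equality of the kernels of \<nu> and
  \<lambda> is what brings \<lambda> into a statement about \<nu>: an element \<open>a\<close> of
  the common kernel is related to \<open>\<epsilon> a\<close> already by the smaller congruence
  \<lambda>, so collapsing the trace of \<lambda> suffices for the cryptogroup equation. In the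
  other direction the obstacle is that this equation is given only inside the kernel, while a
  congruence on the whole semigroup must be built from it. All idempotents lie in the kernel, and up
  to R or L an outside factor can be replaced by its idempotent.\<close>

text \<open>\<open>\<iota> a\<close> is some commuting inner inverse of \<open>a\<close>. It need not lie in the maximal subgroup of \<open>a\<close>
  (the group inverse is \<open>\<epsilon> a \<cdot> \<iota> a\<close>), but \<open>\<epsilon> a\<close> is the identity of that subgroup in any case.\<close>

definition gr_inv :: "('a, 'm) magma_scheme \<Rightarrow> 'a \<Rightarrow> 'a" (\<open>\<iota>\<index>\<close>)
  where "\<iota>\<^bsub>S\<^esub> a = (SOME x. x \<in> carrier S \<and> a \<cdot>\<^bsub>S\<^esub> x \<cdot>\<^bsub>S\<^esub> a = a \<and> a \<cdot>\<^bsub>S\<^esub> x = x \<cdot>\<^bsub>S\<^esub> a)"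

definition gr_unit :: "('a, 'm) magma_scheme \<Rightarrow> 'a \<Rightarrow> 'a" (\<open>\<epsilon>\<index>\<close>)
  where "\<epsilon>\<^bsub>S\<^esub> a = a \<cdot>\<^bsub>S\<^esub> \<iota>\<^bsub>S\<^esub> a"

locale cr_semigroup = carrier_semigroup +
  assumes ex_commuting_inverse:
    "a \<in> carrier S \<Longrightarrow> \<exists>x\<in>carrier S. a \<cdot> x \<cdot> a = a \<and> a \<cdot> x = x \<cdot> a"
begin

lemma
  assumes "a \<in> carrier S"
  shows inv_closed [simp, intro]: "\<iota> a \<in> carrier S"
    and mul_inv_mul: "a \<cdot> (\<iota> a \<cdot> a) = a"
    and inv_mul: "\<iota> a \<cdot> a = \<epsilon> a"
    and mul_inv: "a \<cdot> \<iota> a = \<epsilon> a"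
proof -
  have *: "\<iota> a \<in> carrier S \<and> a \<cdot> \<iota> a \<cdot> a = a \<and> a \<cdot> \<iota> a = \<iota> a \<cdot> a"
    unfolding gr_inv_def by (rule someI_ex) (use ex_commuting_inverse[OF assms] in blast)
  then show "\<iota> a \<in> carrier S" by blast
  with * show "a \<cdot> (\<iota> a \<cdot> a) = a" using assms by (simp add: mul_assoc)
  show "\<iota> a \<cdot> a = \<epsilon> a" "a \<cdot> \<iota> a = \<epsilon> a" using * by (simp_all add: gr_unit_def)
qed

lemma unit_closed [simp, intro]: "a \<in> carrier S \<Longrightarrow> \<epsilon> a \<in> carrier S"
  by (simp add: gr_unit_def)

lemma mul_unit [simp]: "a \<in> carrier S \<Longrightarrow> a \<cdot> \<epsilon> a = a"
  using mul_inv_mul inv_mul by simp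

lemma unit_mul [simp]: "a \<in> carrier S \<Longrightarrow> \<epsilon> a \<cdot> a = a"
  by (metis inv_closed inv_mul mul_assoc mul_inv mul_inv_mul)

lemma unit_idem [simp]: "a \<in> carrier S \<Longrightarrow> \<epsilon> a \<cdot> \<epsilon> a = \<epsilon> a"
  by (metis inv_closed inv_mul mul_assoc mul_unit unit_closed)

lemma
  assumes "a \<in> carrier S" "x \<in> carrier S"
  shows unit_mul_assoc [simp]: "\<epsilon> a \<cdot> (a \<cdot> x) = a \<cdot> x"
    and mul_unit_assoc [simp]: "a \<cdot> (\<epsilon> a \<cdot> x) = a \<cdot> x"
  using assms by (simp_all add: mul_assoc[symmetric])

lemma unit_idempotent [simp, intro]: "a \<in> carrier S \<Longrightarrow> \<epsilon> a \<in> idempotents S"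
  by (simp add: idempotents_def)

text \<open>A commuting inner inverse \<open>x\<close> gives
  \<open>a = a \<cdot> (a \<cdot> x)\<close>, and cancelling with \<open>\<iota> a\<close> leaves
  \<open>\<epsilon> a = \<epsilon> a \<cdot> (a \<cdot> x)\<close>. Units can thus be computed from
  whatever inverse is at hand, also in quotients and subsemigroups.\<close>

lemma unit_unique:
  assumes "a \<in> carrier S" "x \<in> carrier S" "a \<cdot> x \<cdot> a = a" "a \<cdot> x = x \<cdot> a"
  shows "\<epsilon> a = a \<cdot> x"
proof -
  have "\<epsilon> a = \<epsilon> a \<cdot> (a \<cdot> x)"
  proof -
    have "a = a \<cdot> (a \<cdot> x)" using assms by (metis mul_assoc)
    then have "\<iota> a \<cdot> a = \<iota> a \<cdot> (a \<cdot> (a \<cdot> x))" by simp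
    also have "\<dots> = (\<iota> a \<cdot> a) \<cdot> (a \<cdot> x)" using assms(1,2) by (simp add: mul_assoc)
    finally show ?thesis using assms(1) by (simp only: inv_mul)
  qed
  also have "\<dots> = a \<cdot> x" using assms(1,2) by simp
  finally show ?thesis .
qed

lemma idempotent_mul: "e \<in> idempotents S \<Longrightarrow> e \<cdot> e = e"
  by (simp add: idempotents_def)

lemma unit_of_idempotent [simp]: "e \<in> idempotents S \<Longrightarrow> \<epsilon> e = e"
  using unit_unique[of e e] by (simp add: idempotents_def)

lemma idempotents_closed [simp]: "e \<in> idempotents S \<Longrightarrow> e \<in> carrier S"
  by (simp add: idempotents_def)

lemma unit_left_fix: "e \<in> carrier S \<Longrightarrow> a \<in> carrier S \<Longrightarrow> e \<cdot> a = a \<Longrightarrow> e \<cdot> \<epsilon> a = \<epsilon> a"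
  by (metis inv_closed mul_assoc mul_inv)

lemma unit_right_fix: "e \<in> carrier S \<Longrightarrow> a \<in> carrier S \<Longrightarrow> a \<cdot> e = a \<Longrightarrow> \<epsilon> a \<cdot> e = \<epsilon> a"
  by (metis inv_closed mul_assoc inv_mul)

section \<open>Green's relations L, R and H in terms of units\<close>

lemma left_ideal_of_eq: "a \<in> carrier S \<Longrightarrow> left_ideal_of S a = {x \<cdot> a |x. x \<in> carrier S}"
  unfolding left_ideal_of_def
  by (rule insert_absorb, rule CollectI, rule exI[of _ "\<epsilon> a"]) simp

lemma right_ideal_of_eq: "a \<in> carrier S \<Longrightarrow> right_ideal_of S a = {a \<cdot> x |x. x \<in> carrier S}"
  unfolding right_ideal_of_def
  by (rule insert_absorb, rule CollectI, rule exI[of _ "\<epsilon> a"]) simp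

text \<open>Because \<open>\<epsilon> b = b \<cdot> \<iota> b\<close>, the right multiples of
  \<open>b\<close> are exactly the elements fixed by \<open>\<epsilon> b\<close> on the left; ideal
  inclusions become equations.\<close>

lemma right_ideal_of_subset_iff:
  assumes "a \<in> carrier S" "b \<in> carrier S"
  shows "right_ideal_of S a \<subseteq> right_ideal_of S b \<longleftrightarrow> \<epsilon> b \<cdot> a = a"
proof
  assume "right_ideal_of S a \<subseteq> right_ideal_of S b"
  then have "a \<in> {b \<cdot> x |x. x \<in> carrier S}"
    using assms right_ideal_of_eq by (auto simp: right_ideal_of_def)
  then show "\<epsilon> b \<cdot> a = a" using assms by (auto simp: mul_assoc[symmetric])
next
  assume *: "\<epsilon> b \<cdot> a = a"
  have "a \<cdot> x = b \<cdot> (\<iota> b \<cdot> (a \<cdot> x))" if "x \<in> carrier S" for x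
    using assms that * by (simp add: mul_assoc[symmetric] mul_inv)
  then show "right_ideal_of S a \<subseteq> right_ideal_of S b"
    using assms by (fastforce simp: right_ideal_of_eq)
qed

lemma left_ideal_of_subset_iff:
  assumes "a \<in> carrier S" "b \<in> carrier S"
  shows "left_ideal_of S a \<subseteq> left_ideal_of S b \<longleftrightarrow> a \<cdot> \<epsilon> b = a"
proof
  assume "left_ideal_of S a \<subseteq> left_ideal_of S b"
  then have "a \<in> {x \<cdot> b |x. x \<in> carrier S}"
    using assms left_ideal_of_eq by (auto simp: left_ideal_of_def)
  then show "a \<cdot> \<epsilon> b = a" using assms by (auto simp: mul_assoc)
next
  assume *: "a \<cdot> \<epsilon> b = a"
  have "x \<cdot> a = ((x \<cdot> a) \<cdot> \<iota> b) \<cdot> b" if "x \<in> carrier S" for x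
    using assms that * by (simp add: mul_assoc inv_mul)
  then show "left_ideal_of S a \<subseteq> left_ideal_of S b"
    using assms by (fastforce simp: left_ideal_of_eq)
qed

lemma green_R_iff:
  "(a, b) \<in> green_R S \<longleftrightarrow> a \<in> carrier S \<and> b \<in> carrier S \<and> \<epsilon> a \<cdot> b = b \<and> \<epsilon> b \<cdot> a = a"
  unfolding green_R_def using right_ideal_of_subset_iff by blast

lemma green_L_iff:
  "(a, b) \<in> green_L S \<longleftrightarrow> a \<in> carrier S \<and> b \<in> carrier S \<and> a \<cdot> \<epsilon> b = a \<and> b \<cdot> \<epsilon> a = b"
  unfolding green_L_def using left_ideal_of_subset_iff by blast

text \<open>R gives \<open>\<epsilon> a \<cdot> \<epsilon> b = \<epsilon> b\<close> and L gives
  \<open>\<epsilon> a \<cdot> \<epsilon> b = \<epsilon> a\<close>.\<close>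

lemma green_H_iff:
  "(a, b) \<in> green_H S \<longleftrightarrow> a \<in> carrier S \<and> b \<in> carrier S \<and> \<epsilon> a = \<epsilon> b"
  unfolding green_H_def Int_iff green_R_iff green_L_iff
  by (metis mul_unit unit_closed unit_left_fix unit_mul unit_right_fix)

lemma green_R_mul_left:
  assumes "(a, b) \<in> green_R S" "c \<in> carrier S"
  shows "(c \<cdot> a, c \<cdot> b) \<in> green_R S"
proof -
  have *: "\<epsilon> (c \<cdot> x) \<cdot> (c \<cdot> y) = c \<cdot> y" if "x \<in> carrier S" "y \<in> carrier S" "\<epsilon> x \<cdot> y = y" for x y
  proof -
    have "c \<cdot> y = (c \<cdot> x) \<cdot> (\<iota> x \<cdot> y)"
      using that assms(2) by (metis inv_closed mul_assoc mul_closed mul_inv)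
    then show ?thesis
      using that assms(2) by (metis inv_closed mul_assoc mul_closed unit_closed unit_mul)
  qed
  show ?thesis using assms * by (simp add: green_R_iff)
qed

lemma green_L_mul_right:
  assumes "(a, b) \<in> green_L S" "c \<in> carrier S"
  shows "(a \<cdot> c, b \<cdot> c) \<in> green_L S"
proof -
  have *: "(y \<cdot> c) \<cdot> \<epsilon> (x \<cdot> c) = y \<cdot> c" if "x \<in> carrier S" "y \<in> carrier S" "y \<cdot> \<epsilon> x = y" for x y
  proof -
    have "y \<cdot> c = (y \<cdot> \<iota> x) \<cdot> (x \<cdot> c)"
      using that assms(2) by (metis inv_closed mul_assoc mul_closed inv_mul)
    then show ?thesis
      using that assms(2) by (metis inv_closed mul_assoc mul_closed unit_closed mul_unit)
  qed
  show ?thesis using assms * by (simp add: green_L_iff)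
qed

lemma green_R_unit: "a \<in> carrier S \<Longrightarrow> (a, \<epsilon> a) \<in> green_R S"
  by (simp add: green_R_iff)

lemma green_R_sym: "(a, b) \<in> green_R S \<Longrightarrow> (b, a) \<in> green_R S"
  by (simp add: green_R_def)

lemma green_R_trans: "(a, b) \<in> green_R S \<Longrightarrow> (b, c) \<in> green_R S \<Longrightarrow> (a, c) \<in> green_R S"
  by (simp add: green_R_def)

lemma green_L_unit: "a \<in> carrier S \<Longrightarrow> (a, \<epsilon> a) \<in> green_L S"
  by (simp add: green_L_iff)

lemma green_L_sym: "(a, b) \<in> green_L S \<Longrightarrow> (b, a) \<in> green_L S"
  by (simp add: green_L_def)

lemma green_L_trans: "(a, b) \<in> green_L S \<Longrightarrow> (b, c) \<in> green_L S \<Longrightarrow> (a, c) \<in> green_L S"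
  by (simp add: green_L_def)

section \<open>The J-preorder, and D = J\<close>

definition J_below :: "'a \<Rightarrow> 'a \<Rightarrow> bool"
  where "J_below a b \<longleftrightarrow> (\<exists>x\<in>carrier S. \<exists>y\<in>carrier S. a = x \<cdot> b \<cdot> y)"

lemma J_belowI: "x \<in> carrier S \<Longrightarrow> y \<in> carrier S \<Longrightarrow> a = x \<cdot> b \<cdot> y \<Longrightarrow> J_below a b"
  unfolding J_below_def by blast

text \<open>The unit stands in for an adjoined identity, so \<open>J_below\<close> is the preorder
  of principal two-sided ideals although its factors range over the carrier only.\<close>

lemma J_below_refl: "a \<in> carrier S \<Longrightarrow> J_below a a"
  by (rule J_belowI[of "\<epsilon> a" "\<epsilon> a"]) auto

lemma J_below_trans:
  assumes "J_below a b" "J_below b c" "c \<in> carrier S"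
  shows "J_below a c"
proof -
  obtain x y u v where *: "x \<in> carrier S" "y \<in> carrier S" "u \<in> carrier S" "v \<in> carrier S"
    "a = x \<cdot> b \<cdot> y" "b = u \<cdot> c \<cdot> v"
    using assms unfolding J_below_def by blast
  then have "a = (x \<cdot> u) \<cdot> c \<cdot> (v \<cdot> y)" using assms(3) by (simp add: mul_assoc)
  then show ?thesis using * by (intro J_belowI) auto
qed

lemma J_below_mul:
  assumes "a \<in> carrier S" "b \<in> carrier S"
  shows "J_below (a \<cdot> b) a" "J_below (a \<cdot> b) b"
   apply (rule J_belowI[of "\<epsilon> a" b]; use assms in simp)
  apply (rule J_belowI[of a "\<epsilon> b"]; use assms in \<open>simp add: mul_assoc\<close>)
  done

text \<open>\<open>a \<cdot> b\<close> is a multiple of its own square, which contains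
  \<open>b \<cdot> a\<close> in the middle. This rotation is what makes J a congruence with
  commutative quotient.\<close>

lemma J_below_swap:
  assumes "a \<in> carrier S" "b \<in> carrier S"
  shows "J_below (a \<cdot> b) (b \<cdot> a)"
proof -
  have "a \<cdot> b = (a \<cdot> b) \<cdot> ((a \<cdot> b) \<cdot> \<iota> (a \<cdot> b))" using assms by (simp add: mul_inv)
  also have "\<dots> = a \<cdot> (b \<cdot> a) \<cdot> (b \<cdot> \<iota> (a \<cdot> b))" using assms by (simp add: mul_assoc)
  finally show ?thesis using assms by (intro J_belowI) auto
qed

lemma J_below_mul_right:
  assumes "J_below a b" "b \<in> carrier S" "c \<in> carrier S"
  shows "J_below (a \<cdot> c) (b \<cdot> c)"
proof -
  obtain x y where xy: "x \<in> carrier S" "y \<in> carrier S" "a = x \<cdot> b \<cdot> y"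
    using assms unfolding J_below_def by blast
  then have "a \<cdot> c = x \<cdot> (b \<cdot> (y \<cdot> c))" using assms by (simp add: mul_assoc)
  then have "J_below (a \<cdot> c) (b \<cdot> (y \<cdot> c))" using J_below_mul xy assms by simp
  \<comment> \<open>The factor \<open>y\<close> is stuck between \<open>b\<close> and
    \<open>c\<close>. One rotation brings it to the front, where it is dropped; a second one
    restores the order.\<close>
  moreover have "J_below (b \<cdot> (y \<cdot> c)) (y \<cdot> (c \<cdot> b))"
    using J_below_swap[of b "y \<cdot> c"] xy assms by (simp add: mul_assoc)
  moreover have "J_below (y \<cdot> (c \<cdot> b)) (c \<cdot> b)" using J_below_mul xy assms by simp
  moreover have "J_below (c \<cdot> b) (b \<cdot> c)" using J_below_swap assms by simp
  ultimately show ?thesis using J_below_trans xy assms by (meson mul_closed)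
qed

lemma J_below_mul_left:
  assumes "J_below a b" "a \<in> carrier S" "b \<in> carrier S" "c \<in> carrier S"
  shows "J_below (c \<cdot> a) (c \<cdot> b)"
  using J_below_mul_right[OF assms(1,3,4)] J_below_swap assms J_below_trans
  by (meson mul_closed)

text \<open>Products are hard to control in the composition of L and R, whereas the J-form admits
  the rotation arguments above; this is how D is later shown to be a congruence.\<close>

lemma green_D_iff:
  "(a, b) \<in> green_D S \<longleftrightarrow> a \<in> carrier S \<and> b \<in> carrier S \<and> J_below a b \<and> J_below b a"
proof
  assume "(a, b) \<in> green_D S"
  then obtain c where "(a, c) \<in> green_L S" "(c, b) \<in> green_R S"
    unfolding green_D_def by blast
  then have *: "a \<in> carrier S" "c \<in> carrier S" "b \<in> carrier S"
    "a \<cdot> \<epsilon> c = a" "c \<cdot> \<epsilon> a = c" "\<epsilon> c \<cdot> b = b" "\<epsilon> b \<cdot> c = c"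
    by (simp_all add: green_L_iff green_R_iff)
  have "a = (a \<cdot> \<iota> c) \<cdot> c" using * by (simp add: mul_assoc inv_mul)
  moreover have "c = (c \<cdot> \<iota> a) \<cdot> a" using * by (simp add: mul_assoc inv_mul)
  moreover have "b = c \<cdot> (\<iota> c \<cdot> b)" using * by (simp add: mul_assoc[symmetric] mul_inv)
  moreover have "c = b \<cdot> (\<iota> b \<cdot> c)" using * by (simp add: mul_assoc[symmetric] mul_inv)
  ultimately have "J_below a c" "J_below c a" "J_below b c" "J_below c b"
    using J_below_mul * by (metis inv_closed mul_closed)+
  then show "a \<in> carrier S \<and> b \<in> carrier S \<and> J_below a b \<and> J_below b a"
    using * J_below_trans by blast
next
  assume *: "a \<in> carrier S \<and> b \<in> carrier S \<and> J_below a b \<and> J_below b a"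
  then have ab: "a \<in> carrier S" "b \<in> carrier S" by auto
  obtain x y u v where xy: "x \<in> carrier S" "y \<in> carrier S" "u \<in> carrier S" "v \<in> carrier S"
    "a = x \<cdot> b \<cdot> y" "b = u \<cdot> a \<cdot> v"
    using * unfolding J_below_def by blast
  \<comment> \<open>Substituting one factorization into the other gives
    \<open>a = p \<cdot> a \<cdot> q\<close>. Hence \<open>\<epsilon> p\<close> and
    \<open>\<epsilon> q\<close> fix \<open>a\<close>, and \<open>\<iota> p\<close>,
    \<open>\<iota> q\<close> recover \<open>a\<close> from \<open>u \<cdot> a\<close> and from
    \<open>a \<cdot> v\<close>: these stay in the L-class and the R-class of
    \<open>a\<close>.\<close>
  define p q where "p = x \<cdot> u" "q = v \<cdot> y"
  have pq: "p \<in> carrier S" "q \<in> carrier S" using xy by (auto simp: p_q_def)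
  have "a = x \<cdot> (u \<cdot> a \<cdot> v) \<cdot> y" using xy by metis
  also have "\<dots> = p \<cdot> a \<cdot> q" unfolding p_q_def using xy(1-4) ab by (simp add: mul_assoc)
  finally have a: "a = p \<cdot> a \<cdot> q" .
  have pa: "\<epsilon> p \<cdot> a = a" using a pq ab by (metis mul_assoc mul_closed unit_closed unit_mul)
  have aq: "a \<cdot> \<epsilon> q = a" using a pq ab by (metis mul_assoc mul_closed unit_closed mul_unit)
  have 1: "a = (\<iota> p \<cdot> x) \<cdot> (u \<cdot> a)"
  proof -
    have "a = \<iota> p \<cdot> p \<cdot> a" using pa pq by (simp add: inv_mul)
    also have "\<dots> = (\<iota> p \<cdot> x) \<cdot> (u \<cdot> a)" using pq xy(1-4) ab by (simp add: p_q_def mul_assoc)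
    finally show ?thesis .
  qed
  have 2: "a = (a \<cdot> v) \<cdot> (y \<cdot> \<iota> q)"
  proof -
    have "a = a \<cdot> (q \<cdot> \<iota> q)" using aq pq by (simp add: mul_inv)
    also have "\<dots> = (a \<cdot> v) \<cdot> (y \<cdot> \<iota> q)" using pq xy(1-4) ab by (simp add: p_q_def mul_assoc)
    finally show ?thesis .
  qed
  have "a \<cdot> \<epsilon> (u \<cdot> a) = a"
    using 1 ab xy(1-4) pq by (metis inv_closed mul_assoc mul_closed mul_unit unit_closed)
  moreover have "u \<cdot> a \<cdot> \<epsilon> a = u \<cdot> a" using ab xy(1-4) by (simp add: mul_assoc)
  ultimately have "(a, u \<cdot> a) \<in> green_L S" using ab xy(1-4) by (simp add: green_L_iff)
  moreover have "\<epsilon> (a \<cdot> v) \<cdot> a = a"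
    using 2 ab xy(1-4) pq by (metis inv_closed mul_assoc mul_closed unit_mul unit_closed)
  moreover have "\<epsilon> a \<cdot> (a \<cdot> v) = a \<cdot> v" using ab xy(1-4) by (simp add: mul_assoc[symmetric])
  ultimately have "(a, a \<cdot> v) \<in> green_R S" using ab xy(1-4) by (simp add: green_R_iff)
  then have "(u \<cdot> a, b) \<in> green_R S" using green_R_mul_left xy ab by (metis mul_assoc)
  with \<open>(a, u \<cdot> a) \<in> green_L S\<close> show "(a, b) \<in> green_D S" unfolding green_D_def by blast
qed

end

section \<open>Maximal subgroups, and the equivalence with unions of subgroups\<close>

context cr_semigroup
begin

lemma unit_mul_eq:
  assumes "a \<in> carrier S" "b \<in> carrier S" "\<epsilon> a = \<epsilon> b"
  shows "\<epsilon> (a \<cdot> b) = \<epsilon> b"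
proof -
  have ab: "a \<cdot> \<epsilon> b = a" "\<epsilon> b \<cdot> b = b" "\<epsilon> a \<cdot> b = b" using assms by (metis mul_unit unit_mul)+
  have l: "(a \<cdot> b) \<cdot> (\<iota> b \<cdot> \<iota> a) = \<epsilon> b"
  proof -
    have "(a \<cdot> b) \<cdot> (\<iota> b \<cdot> \<iota> a) = a \<cdot> (b \<cdot> \<iota> b) \<cdot> \<iota> a" using assms by (simp add: mul_assoc)
    then show ?thesis using assms ab by (simp add: mul_inv)
  qed
  have r: "(\<iota> b \<cdot> \<iota> a) \<cdot> (a \<cdot> b) = \<epsilon> b"
  proof -
    have "(\<iota> b \<cdot> \<iota> a) \<cdot> (a \<cdot> b) = \<iota> b \<cdot> ((\<iota> a \<cdot> a) \<cdot> b)" using assms by (simp add: mul_assoc)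
    then show ?thesis using assms ab by (simp add: inv_mul)
  qed
  have "\<epsilon> b \<cdot> (a \<cdot> b) = a \<cdot> b" using assms by (metis mul_assoc unit_closed unit_mul)
  then have "\<epsilon> (a \<cdot> b) = (a \<cdot> b) \<cdot> (\<iota> b \<cdot> \<iota> a)"
    using l r assms by (intro unit_unique) simp_all
  then show ?thesis using l by simp
qed

lemma completely_regular: "completely_regular S"
  unfolding completely_regular_def
proof (intro conjI equalityI subsetI)
  show "carrier_semigroup S" ..
  fix a assume a: "a \<in> carrier S"
  let ?G = "{x \<in> carrier S. \<epsilon> x = \<epsilon> a}"
  have "group \<lparr>carrier = ?G, monoid.mult = mul S, one = \<epsilon> a\<rparr>"
  proof (rule groupI; clarsimp)
    fix x assume x: "x \<in> carrier S" and eq: "\<epsilon> x = \<epsilon> a"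
    \<comment> \<open>\<open>\<iota> x\<close> alone may lie outside \<open>?G\<close>; the factor
      \<open>\<epsilon> x\<close> moves it into the maximal subgroup.\<close>
    let ?y = "\<epsilon> x \<cdot> \<iota> x"
    have y: "x \<cdot> ?y = \<epsilon> x" "?y \<cdot> x = \<epsilon> x"
      using x by (simp_all add: mul_assoc mul_inv inv_mul)
    moreover have "\<epsilon> ?y = ?y \<cdot> x"
      using x y by (intro unit_unique) (simp_all add: mul_assoc[symmetric])
    ultimately show "\<exists>y. y \<in> carrier S \<and> \<epsilon> y = \<epsilon> a \<and> y \<cdot> x = \<epsilon> a"
      using a x eq by (intro exI[of _ ?y]) simp
  next
    fix x assume "x \<in> carrier S" "\<epsilon> x = \<epsilon> a"
    then show "\<epsilon> a \<cdot> x = x" by (metis unit_mul)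
  qed (use a in \<open>simp_all add: mul_assoc unit_mul_eq\<close>)
  then have "?G \<in> subgroups S" unfolding subgroups_def by blast
  with a show "a \<in> \<Union> (subgroups S)" by blast
qed (auto simp: subgroups_def)

end

lemma completely_regular_iff_cr_semigroup: "completely_regular S \<longleftrightarrow> cr_semigroup S"
proof
  assume *: "completely_regular S"
  show "cr_semigroup S"
  proof (intro cr_semigroup.intro cr_semigroup_axioms.intro)
    show "carrier_semigroup S" using * by (simp add: completely_regular_def)
    fix a assume "a \<in> carrier S"
    then obtain G e where G: "a \<in> G" "G \<subseteq> carrier S"
      "group \<lparr>carrier = G, monoid.mult = mul S, one = e\<rparr>"
      using * unfolding completely_regular_def subgroups_def by blast
    let ?G = "\<lparr>carrier = G, monoid.mult = mul S, one = e\<rparr>"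
    interpret G: group ?G by fact
    let ?x = "m_inv ?G a"
    have "?x \<in> G" using G.inv_closed[of a] G(1) by simp
    moreover have "a \<cdot>\<^bsub>S\<^esub> ?x = e" "?x \<cdot>\<^bsub>S\<^esub> a = e" "e \<cdot>\<^bsub>S\<^esub> a = a"
      using G.r_inv[of a] G.l_inv[of a] G.l_one[of a] G(1) by simp_all
    ultimately show "\<exists>x\<in>carrier S. a \<cdot>\<^bsub>S\<^esub> x \<cdot>\<^bsub>S\<^esub> a = a \<and> a \<cdot>\<^bsub>S\<^esub> x = x \<cdot>\<^bsub>S\<^esub> a"
      using G(2) by (intro bexI[of _ ?x]) auto
  qed
qed (rule cr_semigroup.completely_regular)

lemma (in cr_semigroup) regular_semigroup: "regular_semigroup S"
  unfolding regular_semigroup_def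
  using carrier_semigroup_axioms ex_commuting_inverse by blast

section \<open>Congruences, quotients and kernels\<close>

lemma
  assumes "congruence S \<rho>"
  shows congruence_equiv: "equiv (carrier S) \<rho>"
    and congruence_mul: "(a, b) \<in> \<rho> \<Longrightarrow> (c, d) \<in> \<rho> \<Longrightarrow> (a \<cdot>\<^bsub>S\<^esub> c, b \<cdot>\<^bsub>S\<^esub> d) \<in> \<rho>"
    and congruence_refl: "a \<in> carrier S \<Longrightarrow> (a, a) \<in> \<rho>"
    and congruence_sym: "(a, b) \<in> \<rho> \<Longrightarrow> (b, a) \<in> \<rho>"
    and congruence_trans [trans]: "(a, b) \<in> \<rho> \<Longrightarrow> (b, c) \<in> \<rho> \<Longrightarrow> (a, c) \<in> \<rho>"
    and congruence_closed: "(a, b) \<in> \<rho> \<Longrightarrow> a \<in> carrier S \<and> b \<in> carrier S"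
proof -
  show equiv: "equiv (carrier S) \<rho>" using assms by (simp add: congruence_def)
  show "(a, b) \<in> \<rho> \<Longrightarrow> (c, d) \<in> \<rho> \<Longrightarrow> (a \<cdot>\<^bsub>S\<^esub> c, b \<cdot>\<^bsub>S\<^esub> d) \<in> \<rho>"
    using assms unfolding congruence_def by fast
  show "a \<in> carrier S \<Longrightarrow> (a, a) \<in> \<rho>" using equiv by (meson equivE refl_onD)
  show "(a, b) \<in> \<rho> \<Longrightarrow> (b, a) \<in> \<rho>" using equiv by (meson equivE symD)
  show "(a, b) \<in> \<rho> \<Longrightarrow> (b, c) \<in> \<rho> \<Longrightarrow> (a, c) \<in> \<rho>" using equiv by (meson equivE transD)
  show "(a, b) \<in> \<rho> \<Longrightarrow> a \<in> carrier S \<and> b \<in> carrier S"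
    using equiv_type[OF equiv] by blast
qed

lemma congruenceI:
  assumes "\<rho> \<subseteq> carrier S \<times> carrier S"
    and "\<And>a. a \<in> carrier S \<Longrightarrow> (a, a) \<in> \<rho>"
    and "\<And>a b. (a, b) \<in> \<rho> \<Longrightarrow> (b, a) \<in> \<rho>"
    and trans: "\<And>a b c. (a, b) \<in> \<rho> \<Longrightarrow> (b, c) \<in> \<rho> \<Longrightarrow> (a, c) \<in> \<rho>"
    and left: "\<And>a b c. (a, b) \<in> \<rho> \<Longrightarrow> c \<in> carrier S \<Longrightarrow> (c \<cdot>\<^bsub>S\<^esub> a, c \<cdot>\<^bsub>S\<^esub> b) \<in> \<rho>"
    and right: "\<And>a b c. (a, b) \<in> \<rho> \<Longrightarrow> c \<in> carrier S \<Longrightarrow> (a \<cdot>\<^bsub>S\<^esub> c, b \<cdot>\<^bsub>S\<^esub> c) \<in> \<rho>"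
  shows "congruence S \<rho>"
  unfolding congruence_def
proof (intro conjI equivI refl_onI symI transI)
  have "(a \<cdot>\<^bsub>S\<^esub> c, b \<cdot>\<^bsub>S\<^esub> d) \<in> \<rho>" if "(a, b) \<in> \<rho>" "(c, d) \<in> \<rho>" for a b c d
  proof (rule trans)
    show "(a \<cdot>\<^bsub>S\<^esub> c, b \<cdot>\<^bsub>S\<^esub> c) \<in> \<rho>" using that assms(1) right by blast
    show "(b \<cdot>\<^bsub>S\<^esub> c, b \<cdot>\<^bsub>S\<^esub> d) \<in> \<rho>" using that assms(1) left by blast
  qed
  then show "\<forall>(a, b)\<in>\<rho>. \<forall>(c, d)\<in>\<rho>. (a \<cdot>\<^bsub>S\<^esub> c, b \<cdot>\<^bsub>S\<^esub> d) \<in> \<rho>" by blast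
qed (use assms in blast)+

lemma congruence_Inter:
  assumes "F \<noteq> {}" "\<And>\<sigma>. \<sigma> \<in> F \<Longrightarrow> congruence S \<sigma>"
  shows "congruence S (\<Inter>F)"
proof (rule congruenceI)
  obtain \<sigma> where "\<sigma> \<in> F" using assms(1) by blast
  then show "\<Inter>F \<subseteq> carrier S \<times> carrier S" using assms(2) congruence_closed by fastforce
next
  fix a b c assume "(a, b) \<in> \<Inter>F" "(b, c) \<in> \<Inter>F"
  then show "(a, c) \<in> \<Inter>F" using congruence_trans[OF assms(2)] by blast
next
  fix a b c assume "(a, b) \<in> \<Inter>F" and c: "c \<in> carrier S"
  then have ab: "\<And>\<sigma>. \<sigma> \<in> F \<Longrightarrow> (a, b) \<in> \<sigma>" by blast
  show "(c \<cdot>\<^bsub>S\<^esub> a, c \<cdot>\<^bsub>S\<^esub> b) \<in> \<Inter>F" "(a \<cdot>\<^bsub>S\<^esub> c, b \<cdot>\<^bsub>S\<^esub> c) \<in> \<Inter>F"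
    using assms(2) ab c by (blast intro: congruence_mul congruence_refl)+
qed (use congruence_refl[OF assms(2)] congruence_sym[OF assms(2)] in blast)+

text \<open>Inclusion is only a partial order, so \<open>LEAST\<close> says something only once a
  minimum is exhibited: the intersection of the family. The member \<open>\<sigma>\<close> keeps the
  family nonempty, as \<open>\<Inter>{}\<close> would be the universal set.\<close>

lemma is_least_congruence_least_congruence:
  assumes "congruence S \<sigma>" "P \<sigma>"
    and "\<And>F. F \<noteq> {} \<Longrightarrow> (\<And>\<tau>. \<tau> \<in> F \<Longrightarrow> congruence S \<tau> \<and> P \<tau>) \<Longrightarrow> P (\<Inter>F)"
  shows "is_least_congruence S P (least_congruence S P)"
proof -
  let ?F = "{\<tau>. congruence S \<tau> \<and> P \<tau>}"
  have "?F \<noteq> {}" using assms(1,2) by blast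
  then have "congruence S (\<Inter>?F)" by (rule congruence_Inter) simp
  moreover have "P (\<Inter>?F)" using \<open>?F \<noteq> {}\<close> by (rule assms(3)) simp
  ultimately have "is_least_congruence S P (\<Inter>?F)"
    unfolding is_least_congruence_def by (simp add: Inter_lower)
  then show ?thesis using least_congruence_eqI by metis
qed

lemma trace_lower_is_least:
  assumes "congruence S \<rho>"
  shows "is_least_congruence S (\<lambda>\<sigma>. trace S \<sigma> = trace S \<rho>) (trace_lower S \<rho>)"
  unfolding trace_lower_def
  by (rule is_least_congruence_least_congruence[OF assms]) (auto simp: trace_def; blast)+

text \<open>Intersecting the least congruence with \<open>\<sigma>\<close> leaves its trace
  unchanged, so it already lies in \<open>\<sigma>\<close>. Upper bounds thus require only an
  inclusion of idempotent pairs.\<close>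

lemma trace_lower_subset:
  assumes "congruence S \<rho>" "congruence S \<sigma>" "trace S \<rho> \<subseteq> \<sigma>"
  shows "trace_lower S \<rho> \<subseteq> \<sigma>"
proof -
  let ?t = "trace_lower S \<rho>"
  have t: "congruence S ?t" "trace S ?t = trace S \<rho>"
    and least: "\<And>\<tau>. congruence S \<tau> \<Longrightarrow> trace S \<tau> = trace S \<rho> \<Longrightarrow> ?t \<subseteq> \<tau>"
    using trace_lower_is_least[OF assms(1)] unfolding is_least_congruence_def by blast+
  have "congruence S (?t \<inter> \<sigma>)" using congruence_Inter[of "{?t, \<sigma>}" S] t(1) assms(2) by auto
  moreover have "trace S (?t \<inter> \<sigma>) = trace S \<rho>" using t(2) assms(3) unfolding trace_def by blast
  ultimately show ?thesis using least by blast
qed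

section \<open>Quotient, units and kernel of a congruence\<close>

locale cr_congruence = cr_semigroup +
  fixes \<rho> :: "'a rel"
  assumes congruence: "congruence S \<rho>"
begin

lemmas cong_mul = congruence_mul[OF congruence]
lemmas cong_refl [simp, intro] = congruence_refl[OF congruence]
lemmas cong_sym = congruence_sym[OF congruence]
lemmas cong_trans [trans] = congruence_trans[OF congruence]
lemmas cong_closed = congruence_closed[OF congruence]

lemma cong_mul_left: "(a, b) \<in> \<rho> \<Longrightarrow> c \<in> carrier S \<Longrightarrow> (c \<cdot> a, c \<cdot> b) \<in> \<rho>"
  by (rule cong_mul) auto

lemma cong_mul_right: "(a, b) \<in> \<rho> \<Longrightarrow> c \<in> carrier S \<Longrightarrow> (a \<cdot> c, b \<cdot> c) \<in> \<rho>"
  by (rule cong_mul) auto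

abbreviation quotient ("Q")
  where "Q \<equiv> quotient_semigroup S \<rho>"

abbreviation cls :: "'a \<Rightarrow> 'a set"
  where "cls a \<equiv> \<rho> `` {a}"

lemma carrier_quotient: "carrier Q = cls ` carrier S"
  by (auto simp: quotient_semigroup_def quotient_def)

lemma cls_closed [simp, intro]: "a \<in> carrier S \<Longrightarrow> cls a \<in> carrier Q"
  by (simp add: carrier_quotient)

lemma cls_mul: "a \<in> carrier S \<Longrightarrow> b \<in> carrier S \<Longrightarrow> cls a \<cdot>\<^bsub>Q\<^esub> cls b = cls (a \<cdot> b)"
  by (rule mul_quotient_semigroup[OF congruence])

lemma cls_eq_iff: "a \<in> carrier S \<Longrightarrow> b \<in> carrier S \<Longrightarrow> cls a = cls b \<longleftrightarrow> (a, b) \<in> \<rho>"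
  by (rule eq_equiv_class_iff[OF congruence_equiv[OF congruence]])

lemma cls_cases:
  assumes "A \<in> carrier Q"
  obtains a where "a \<in> carrier S" "A = cls a"
  using assms by (auto simp: carrier_quotient)

lemma cr_semigroup_quotient: "cr_semigroup Q"
proof (unfold_locales)
  fix A B C assume "A \<in> carrier Q" "B \<in> carrier Q" "C \<in> carrier Q"
  then obtain a b c where "a \<in> carrier S" "b \<in> carrier S" "c \<in> carrier S"
    "A = cls a" "B = cls b" "C = cls c"
    by (meson cls_cases)
  then show "(A \<cdot>\<^bsub>Q\<^esub> B) \<cdot>\<^bsub>Q\<^esub> C = A \<cdot>\<^bsub>Q\<^esub> (B \<cdot>\<^bsub>Q\<^esub> C)"
    by (simp add: cls_mul mul_assoc)
next
  fix A B assume "A \<in> carrier Q" "B \<in> carrier Q"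
  then show "A \<cdot>\<^bsub>Q\<^esub> B \<in> carrier Q" by (metis cls_cases cls_closed cls_mul mul_closed)
next
  fix A assume "A \<in> carrier Q"
  then obtain a where a: "a \<in> carrier S" "A = cls a" by (rule cls_cases)
  then show "\<exists>X\<in>carrier Q. A \<cdot>\<^bsub>Q\<^esub> X \<cdot>\<^bsub>Q\<^esub> A = A \<and> A \<cdot>\<^bsub>Q\<^esub> X = X \<cdot>\<^bsub>Q\<^esub> A"
    by (intro bexI[of _ "cls (\<iota> a)"]) (simp_all add: cls_mul mul_inv inv_mul)
qed

text \<open>The \<open>\<iota>\<close> of the quotient is an independent choice, but the class of
  \<open>\<iota> a\<close> is also a commuting inverse, and this determines the unit.\<close>

lemma unit_cls: "a \<in> carrier S \<Longrightarrow> \<epsilon>\<^bsub>Q\<^esub> (cls a) = cls (\<epsilon> a)"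
  using cr_semigroup.unit_unique[OF cr_semigroup_quotient, of "cls a" "cls (\<iota> a)"]
  by (simp add: cls_mul mul_inv inv_mul)

lemma cong_unit: "(a, b) \<in> \<rho> \<Longrightarrow> (\<epsilon> a, \<epsilon> b) \<in> \<rho>"
  using cls_eq_iff unit_cls cong_closed by (metis unit_closed)

lemma square_cong_iff: "a \<in> carrier S \<Longrightarrow> (a, a \<cdot> a) \<in> \<rho> \<longleftrightarrow> (a, \<epsilon> a) \<in> \<rho>"
proof
  assume a: "a \<in> carrier S" "(a, a \<cdot> a) \<in> \<rho>"
  then have "(a \<cdot> \<iota> a, (a \<cdot> a) \<cdot> \<iota> a) \<in> \<rho>" by (intro cong_mul_right) auto
  then show "(a, \<epsilon> a) \<in> \<rho>" using a by (simp add: mul_assoc mul_inv cong_sym)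
next
  assume a: "a \<in> carrier S" "(a, \<epsilon> a) \<in> \<rho>"
  then show "(a, a \<cdot> a) \<in> \<rho>" using cong_mul_left[OF cong_sym[OF a(2)] a(1)] by simp
qed

text \<open>An idempotent is its own unit, so \<open>(a, e) \<in> \<rho>\<close> forces
  \<open>(\<epsilon> a, e) \<in> \<rho>\<close>. The witness no longer depends on
  \<open>\<rho>\<close>, which lets kernels commute with intersections.\<close>

lemma mem_ker_iff: "a \<in> ker S \<rho> \<longleftrightarrow> a \<in> carrier S \<and> (a, \<epsilon> a) \<in> \<rho>"
proof
  assume "a \<in> ker S \<rho>"
  then obtain e where e: "a \<in> carrier S" "e \<in> idempotents S" "(a, e) \<in> \<rho>"
    by (auto simp: ker_def)
  then have "(\<epsilon> a, e) \<in> \<rho>" using cong_unit by fastforce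
  then show "a \<in> carrier S \<and> (a, \<epsilon> a) \<in> \<rho>" using e by (meson cong_sym cong_trans)
qed (use unit_idempotent in \<open>auto simp: ker_def\<close>)

lemma mem_ker_iff_square: "a \<in> ker S \<rho> \<longleftrightarrow> a \<in> carrier S \<and> (a, a \<cdot> a) \<in> \<rho>"
  using mem_ker_iff square_cong_iff by blast

lemma idempotents_subset_ker: "e \<in> idempotents S \<Longrightarrow> e \<in> ker S \<rho>"
  by (simp add: mem_ker_iff)

lemma cls_idempotent_iff: "a \<in> carrier S \<Longrightarrow> cls a \<in> idempotents Q \<longleftrightarrow> a \<in> ker S \<rho>"
  unfolding idempotents_def mem_ker_iff_square
  by (simp add: cls_mul cls_eq_iff) (blast intro: cong_sym)

text \<open>Lallement's lemma with an explicit lift: the unit of any representative.\<close>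

lemma idempotents_quotient: "idempotents Q = cls ` idempotents S"
proof (intro equalityI subsetI)
  fix A assume A: "A \<in> idempotents Q"
  then have "A \<in> carrier Q" by (simp add: idempotents_def)
  then obtain a where a: "a \<in> carrier S" "A = cls a" by (rule cls_cases)
  then have "A = cls (\<epsilon> a)" using A cls_idempotent_iff mem_ker_iff cls_eq_iff unit_closed by metis
  then show "A \<in> cls ` idempotents S" using a unit_idempotent by blast
next
  fix A assume "A \<in> cls ` idempotents S"
  then show "A \<in> idempotents Q" using cls_idempotent_iff idempotents_subset_ker by auto
qed

text \<open>Only the kernel of \<open>\<rho>\<close> occurs on the right, so orthodoxy of a quotient
  depends on the kernel alone. This underlies \<lambda> = \<nu>_k.\<close>

lemma orthodox_quotient_iff:
  "orthodox Q \<longleftrightarrow> (\<forall>e\<in>idempotents S. \<forall>f\<in>idempotents S. e \<cdot> f \<in> ker S \<rho>)"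
  using cr_semigroup.regular_semigroup[OF cr_semigroup_quotient]
  by (simp add: orthodox_def idempotents_quotient[unfolded image_def] cls_mul
      cls_idempotent_iff[symmetric] flip: image_def)

lemma clifford_quotient_iff:
  "clifford Q \<longleftrightarrow> (\<forall>e\<in>idempotents S. \<forall>a\<in>carrier S. (e \<cdot> a, a \<cdot> e) \<in> \<rho>)"
  using cr_semigroup.completely_regular[OF cr_semigroup_quotient]
  by (simp add: clifford_def idempotents_quotient carrier_quotient cls_mul cls_eq_iff)

lemma orthodox_quotient_if_clifford: "clifford Q \<Longrightarrow> orthodox Q"
proof -
  assume *: "clifford Q"
  have "e \<cdot> f \<in> ker S \<rho>" if e: "e \<in> idempotents S" and f: "f \<in> idempotents S" for e f
  proof -
    have "(e \<cdot> f, f \<cdot> e) \<in> \<rho>" using * e f clifford_quotient_iff by simp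
    \<comment> \<open>Flanking by \<open>e\<close> and \<open>f\<close> turns one side into
      \<open>e \<cdot> f\<close> and the other into its square.\<close>
    then have "(e \<cdot> (e \<cdot> f) \<cdot> f, e \<cdot> (f \<cdot> e) \<cdot> f) \<in> \<rho>"
      using e f by (intro cong_mul_left cong_mul_right) auto
    moreover have "e \<cdot> (e \<cdot> f) \<cdot> f = (e \<cdot> e) \<cdot> (f \<cdot> f)" using e f by (simp add: mul_assoc)
    ultimately show ?thesis
      using e f by (simp add: mem_ker_iff_square idempotent_mul mul_assoc)
  qed
  then show ?thesis by (simp add: orthodox_quotient_iff)
qed

lemma orthodox_ker_mul:
  assumes "orthodox Q" "a \<in> ker S \<rho>" "b \<in> ker S \<rho>"
  shows "a \<cdot> b \<in> ker S \<rho>"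
proof -
  have ab: "a \<in> carrier S" "b \<in> carrier S" using assms(2,3) by (auto simp: mem_ker_iff)
  then have "cls (a \<cdot> b) = cls a \<cdot>\<^bsub>Q\<^esub> cls b" by (simp add: cls_mul)
  also have "\<dots> \<in> idempotents Q"
    using assms ab cls_idempotent_iff by (simp add: orthodox_def)
  finally show ?thesis using ab cls_idempotent_iff by simp
qed

text \<open>If \<open>xy\<close> is congruent to an idempotent then \<open>(yx)\<^sup>3\<close> is congruent to \<open>(yx)\<^sup>2\<close>, and \<open>yx\<close>
  can be cancelled in its subgroup.\<close>

lemma ker_mul_commute:
  assumes "x \<in> carrier S" "y \<in> carrier S" "x \<cdot> y \<in> ker S \<rho>"
  shows "y \<cdot> x \<in> ker S \<rho>"
proof -
  define z where "z = y \<cdot> x"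
  have z: "z \<in> carrier S" using assms by (simp add: z_def)
  have "(x \<cdot> y, (x \<cdot> y) \<cdot> (x \<cdot> y)) \<in> \<rho>" using assms mem_ker_iff_square by blast
  then have "(y \<cdot> (x \<cdot> y) \<cdot> x, y \<cdot> ((x \<cdot> y) \<cdot> (x \<cdot> y)) \<cdot> x) \<in> \<rho>"
    using assms by (intro cong_mul_left cong_mul_right) auto
  then have "(z \<cdot> z, z \<cdot> (z \<cdot> z)) \<in> \<rho>" using assms by (simp add: z_def mul_assoc)
  then have "(\<iota> z \<cdot> (z \<cdot> z), \<iota> z \<cdot> (z \<cdot> (z \<cdot> z))) \<in> \<rho>"
    by (rule cong_mul_left) (use z in auto)
  moreover have "\<iota> z \<cdot> (z \<cdot> w) = \<epsilon> z \<cdot> w" if "w \<in> carrier S" for w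
    using z that by (metis inv_closed inv_mul mul_assoc)
  ultimately have "(z, z \<cdot> z) \<in> \<rho>" using z by simp
  then show ?thesis unfolding z_def[symmetric] using z mem_ker_iff_square by blast
qed

end

section \<open>The least Clifford and the least orthodox congruence\<close>

context cr_semigroup
begin

lemma cr_congruenceI: "congruence S \<rho> \<Longrightarrow> cr_congruence S \<rho>"
  by unfold_locales

lemma congruence_universal: "congruence S (carrier S \<times> carrier S)"
  by (rule congruenceI) auto

lemma congruence_green_D: "congruence S (green_D S)"
proof (rule congruenceI)
  fix a b c assume "(a, b) \<in> green_D S" "(b, c) \<in> green_D S"
  then show "(a, c) \<in> green_D S" unfolding green_D_iff using J_below_trans by blast
next
  fix a b c assume "(a, b) \<in> green_D S" "c \<in> carrier S"
  then show "(c \<cdot> a, c \<cdot> b) \<in> green_D S" "(a \<cdot> c, b \<cdot> c) \<in> green_D S"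
    unfolding green_D_iff using J_below_mul_left J_below_mul_right by auto
qed (auto simp: green_D_iff J_below_refl)

lemma green_D_mul_commute:
  "a \<in> carrier S \<Longrightarrow> b \<in> carrier S \<Longrightarrow> (a \<cdot> b, b \<cdot> a) \<in> green_D S"
  by (simp add: green_D_iff J_below_swap)

text \<open>Being Clifford is thereby a condition on idempotent pairs, which identifies \<nu> as
  D_t.\<close>

lemma clifford_quotient_iff_trace_green_D:
  assumes "congruence S \<rho>"
  shows "clifford (quotient_semigroup S \<rho>) \<longleftrightarrow> trace S (green_D S) \<subseteq> \<rho>"
proof
  interpret cr_congruence S \<rho> using assms by (rule cr_congruenceI)
  {
    assume comm: "clifford Q"
    \<comment> \<open>Writing \<open>e = x \<cdot> f \<cdot> y\<close> and moving the central
      \<open>f\<close> past \<open>x\<close> shows that \<open>f\<close> acts on \<open>e\<close> as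
      an identity modulo \<open>\<rho>\<close>.\<close>
    have *: "(f \<cdot> e, e) \<in> \<rho>"
      if e: "e \<in> idempotents S" and f: "f \<in> idempotents S" and "J_below e f" for e f
    proof -
      obtain x y where xy: "x \<in> carrier S" "y \<in> carrier S" "e = x \<cdot> f \<cdot> y"
        using \<open>J_below e f\<close> unfolding J_below_def by blast
      have "((f \<cdot> x) \<cdot> (f \<cdot> y), (x \<cdot> f) \<cdot> (f \<cdot> y)) \<in> \<rho>"
        using comm f xy clifford_quotient_iff by (intro cong_mul_right) auto
      moreover have "(f \<cdot> x) \<cdot> (f \<cdot> y) = f \<cdot> e"
        using xy f by (simp add: mul_assoc)
      moreover have "(x \<cdot> f) \<cdot> (f \<cdot> y) = x \<cdot> (f \<cdot> f) \<cdot> y" using xy(1,2) f by (simp add: mul_assoc)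
      ultimately show ?thesis using f by (simp add: idempotent_mul flip: xy(3))
    qed
    have "(e, f) \<in> \<rho>"
      if e: "e \<in> idempotents S" and f: "f \<in> idempotents S" and D: "(e, f) \<in> green_D S" for e f
    proof -
      have "(e, f \<cdot> e) \<in> \<rho>" using * e f D cong_sym by (simp add: green_D_iff)
      also have "(f \<cdot> e, e \<cdot> f) \<in> \<rho>" using comm e f clifford_quotient_iff by simp
      also have "(e \<cdot> f, f) \<in> \<rho>" using * e f D by (simp add: green_D_iff)
      finally show ?thesis .
    qed
    then show "trace S (green_D S) \<subseteq> \<rho>" by (auto simp: trace_def)
  }
  assume tr: "trace S (green_D S) \<subseteq> \<rho>"
  have "(e \<cdot> a, a \<cdot> e) \<in> \<rho>" if e: "e \<in> idempotents S" and a: "a \<in> carrier S" for e a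
  proof -
    \<comment> \<open>\<open>e \<cdot> a\<close> and \<open>a \<cdot> e\<close> are D-related, so
      their units agree modulo \<open>\<rho>\<close>. One absorbs \<open>e\<close> on the left, the
      other on the right; once identified, both absorb it on either side, and
      \<open>e \<cdot> a\<close>, \<open>e \<cdot> (a \<cdot> e)\<close>, \<open>a \<cdot> e\<close>
      fall together.\<close>
    let ?g = "\<epsilon> (e \<cdot> a)" and ?h = "\<epsilon> (a \<cdot> e)"
    interpret D: cr_congruence S "green_D S" using congruence_green_D by (rule cr_congruenceI)
    have ee [simp]: "e \<in> carrier S" "e \<cdot> e = e" using e by (auto simp: idempotent_mul)
    have "(?g, ?h) \<in> green_D S" using green_D_mul_commute a by (intro D.cong_unit) simp
    then have gh: "(?g, ?h) \<in> \<rho>" using tr a by (auto simp: trace_def)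
    have eg: "e \<cdot> ?g = ?g" using a by (intro unit_left_fix) (simp_all flip: mul_assoc)
    have he: "?h \<cdot> e = ?h" using a by (intro unit_right_fix) (simp_all add: mul_assoc)
    have "(?g \<cdot> e, ?h \<cdot> e) \<in> \<rho>" using gh a by (intro cong_mul_right) auto
    then have ge: "(?g, ?g \<cdot> e) \<in> \<rho>" using he gh cong_sym cong_trans by metis
    have "(e \<cdot> ?g, e \<cdot> ?h) \<in> \<rho>" using gh a by (intro cong_mul_left) auto
    then have eh: "(e \<cdot> ?h, ?h) \<in> \<rho>" using eg gh cong_sym cong_trans by metis
    have "((e \<cdot> a) \<cdot> ?g, (e \<cdot> a) \<cdot> (?g \<cdot> e)) \<in> \<rho>" using ge a by (intro cong_mul_left) auto
    then have "(e \<cdot> a, (e \<cdot> a) \<cdot> e) \<in> \<rho>" using a by (simp del: mul_assoc)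
    also have "(e \<cdot> a) \<cdot> e = e \<cdot> (a \<cdot> e)" using a by (simp add: mul_assoc)
    also have "(e \<cdot> (a \<cdot> e), a \<cdot> e) \<in> \<rho>"
    proof -
      have "((e \<cdot> ?h) \<cdot> (a \<cdot> e), ?h \<cdot> (a \<cdot> e)) \<in> \<rho>" using eh a by (intro cong_mul_right) auto
      moreover have "(e \<cdot> ?h) \<cdot> (a \<cdot> e) = e \<cdot> (?h \<cdot> (a \<cdot> e))" using a by (intro mul_assoc) auto
      moreover have "?h \<cdot> (a \<cdot> e) = a \<cdot> e" using a by (intro unit_mul) auto
      ultimately show ?thesis by (simp only:)
    qed
    finally show ?thesis .
  qed
  then show "clifford Q" by (simp add: clifford_quotient_iff)
qed

lemma is_least_clifford_congruence:
  "is_least_congruence S (\<lambda>\<sigma>. clifford (quotient_semigroup S \<sigma>)) (trace_lower S (green_D S))"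
proof -
  note D = congruence_green_D
  have t: "congruence S (trace_lower S (green_D S))"
    "trace S (trace_lower S (green_D S)) = trace S (green_D S)"
    using trace_lower_is_least[OF D] by (simp_all add: is_least_congruence_def)
  then have "trace S (green_D S) \<subseteq> trace_lower S (green_D S)" by (metis inf_le1 trace_def)
  then show ?thesis
    using t trace_lower_subset[OF D] clifford_quotient_iff_trace_green_D
    unfolding is_least_congruence_def by blast
qed

lemma least_clifford_congruence_eq:
  "least_clifford_congruence S = trace_lower S (green_D S)"
  unfolding least_clifford_congruence_def
  by (rule least_congruence_eqI[OF is_least_clifford_congruence])

section \<open>The least orthodox congruence and its kernel\<close>

lemma ker_Inter:
  assumes "F \<noteq> {}" "\<And>\<sigma>. \<sigma> \<in> F \<Longrightarrow> congruence S \<sigma>"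
  shows "ker S (\<Inter>F) = (\<Inter>\<sigma>\<in>F. ker S \<sigma>)"
proof -
  have "cr_congruence S (\<Inter>F)" using congruence_Inter[OF assms] by (rule cr_congruenceI)
  note cr_congruence.mem_ker_iff[OF this]
  moreover have "a \<in> ker S \<sigma> \<longleftrightarrow> a \<in> carrier S \<and> (a, \<epsilon> a) \<in> \<sigma>" if "\<sigma> \<in> F" for a \<sigma>
    using cr_congruence.mem_ker_iff[OF cr_congruenceI[OF assms(2)[OF that]]] .
  ultimately show ?thesis using assms(1) by auto
qed

lemma is_least_orthodox_congruence:
  "is_least_congruence S (\<lambda>\<sigma>. orthodox (quotient_semigroup S \<sigma>)) (least_orthodox_congruence S)"
  unfolding least_orthodox_congruence_def
proof (rule is_least_congruence_least_congruence[OF congruence_universal])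
  note iff = cr_congruence.orthodox_quotient_iff[OF cr_congruenceI]
  show "orthodox (quotient_semigroup S (carrier S \<times> carrier S))"
    using cr_congruence.mem_ker_iff[OF cr_congruenceI[OF congruence_universal]]
    by (simp add: iff[OF congruence_universal])
  fix F assume F: "F \<noteq> {}"
    "\<And>\<tau>. \<tau> \<in> F \<Longrightarrow> congruence S \<tau> \<and> orthodox (quotient_semigroup S \<tau>)"
  then have "e \<cdot> f \<in> ker S \<tau>"
    if "\<tau> \<in> F" "e \<in> idempotents S" "f \<in> idempotents S" for e f \<tau>
    using that iff by blast
  moreover have "congruence S (\<Inter>F)" using F by (intro congruence_Inter) auto
  ultimately show "orthodox (quotient_semigroup S (\<Inter>F))"
    using F(2) by (simp add: iff ker_Inter[OF F(1)])
qed

lemma ker_lower_is_least: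
  assumes "congruence S \<rho>"
  shows "is_least_congruence S (\<lambda>\<sigma>. ker S \<sigma> = ker S \<rho>) (ker_lower S \<rho>)"
  unfolding ker_lower_def
  by (rule is_least_congruence_least_congruence[OF assms]) (simp_all add: ker_Inter)

text \<open>Primitivity of idempotents within a D-class: \<open>?p\<close> has \<open>f\<close> as a
  right multiple and is fixed by \<open>g\<close> on the right, which forces its unit to be
  \<open>g\<close> and to fix \<open>f\<close>.\<close>

lemma idempotent_eq_if_J_below:
  assumes g: "g \<in> idempotents S" and f: "f \<in> idempotents S"
    and "J_below f g" and fg: "f \<cdot> g = g" and gf: "g \<cdot> f = g"
  shows "g = f"
proof -
  have [simp]: "f \<in> carrier S" "g \<in> carrier S" "f \<cdot> f = f" "g \<cdot> g = g"
    using f g by (simp_all add: idempotent_mul)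
  obtain x y where xy: "x \<in> carrier S" "y \<in> carrier S" "f = x \<cdot> g \<cdot> y"
    using assms(3) unfolding J_below_def by blast
  let ?p = "f \<cdot> x \<cdot> g"
  have p: "?p \<in> carrier S" using xy by simp
  have "?p \<cdot> y = f \<cdot> (x \<cdot> g \<cdot> y)" using xy(1,2) by (simp add: mul_assoc)
  then have "?p \<cdot> y = f" by (simp flip: xy(3))
  then have *: "\<epsilon> ?p \<cdot> f = f" using p xy by (metis mul_assoc unit_closed unit_mul)
  have "?p \<cdot> g = ?p" using xy by (simp add: mul_assoc)
  then have "\<epsilon> ?p = \<epsilon> ?p \<cdot> g" using p by (intro unit_right_fix[symmetric]) auto
  also have "\<dots> = (\<epsilon> ?p \<cdot> f) \<cdot> g" using p fg by (simp add: mul_assoc)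
  also have "\<dots> = g" using * fg by simp
  finally show ?thesis using * gf by simp
qed

text \<open>The syntactic congruence of the kernel \<open>K\<close> of a congruence with orthodox quotient. Since \<open>K\<close>
  is closed under \<open>xy \<mapsto> yx\<close>, one-sided contexts suffice.\<close>

lemma clifford_congruence_saturating_ker:
  assumes "congruence S \<rho>" "orthodox (quotient_semigroup S \<rho>)"
  obtains \<tau> where "congruence S \<tau>" "clifford (quotient_semigroup S \<tau>)" "ker S \<tau> \<subseteq> ker S \<rho>"
proof
  interpret cr_congruence S \<rho> using assms(1) by (rule cr_congruenceI)
  let ?K = "ker S \<rho>"
  define \<tau> where "\<tau> = {(a, b). a \<in> carrier S \<and> b \<in> carrier S \<and>
    (\<forall>z\<in>carrier S. z \<cdot> a \<in> ?K \<longleftrightarrow> z \<cdot> b \<in> ?K)}"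
  have swap: "x \<cdot> y \<in> ?K \<longleftrightarrow> y \<cdot> x \<in> ?K" if "x \<in> carrier S" "y \<in> carrier S" for x y
    using that ker_mul_commute by blast
  show \<tau>: "congruence S \<tau>"
  proof (rule congruenceI)
    fix a b c assume ab: "(a, b) \<in> \<tau>" and c: "c \<in> carrier S"
    have "z \<cdot> (c \<cdot> a) \<in> ?K \<longleftrightarrow> z \<cdot> (c \<cdot> b) \<in> ?K" if "z \<in> carrier S" for z
    proof -
      have "(z \<cdot> c) \<cdot> a \<in> ?K \<longleftrightarrow> (z \<cdot> c) \<cdot> b \<in> ?K" using ab c that unfolding \<tau>_def by blast
      then show ?thesis using ab c that by (simp add: \<tau>_def mul_assoc)
    qed
    then show "(c \<cdot> a, c \<cdot> b) \<in> \<tau>" using ab c by (simp add: \<tau>_def)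
    have "z \<cdot> (a \<cdot> c) \<in> ?K \<longleftrightarrow> z \<cdot> (b \<cdot> c) \<in> ?K" if "z \<in> carrier S" for z
    proof -
      have "z \<cdot> (x \<cdot> c) \<in> ?K \<longleftrightarrow> (c \<cdot> z) \<cdot> x \<in> ?K" if "x \<in> carrier S" for x
        using swap[of "z \<cdot> x" c] that \<open>z \<in> carrier S\<close> c by (simp add: mul_assoc)
      moreover have "(c \<cdot> z) \<cdot> a \<in> ?K \<longleftrightarrow> (c \<cdot> z) \<cdot> b \<in> ?K" using ab c that unfolding \<tau>_def by blast
      ultimately show ?thesis using ab unfolding \<tau>_def by blast
    qed
    then show "(a \<cdot> c, b \<cdot> c) \<in> \<tau>" using ab c by (simp add: \<tau>_def)
  qed (auto simp: \<tau>_def)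
  \<comment> \<open>To exchange \<open>e\<close> for \<open>f\<close>, the product is enlarged and
    rotated inside \<open>?K\<close> to \<open>f \<cdot> ((e \<cdot> f) \<cdot> z)\<close>; the
    sandwich \<open>f \<cdot> (e \<cdot> f)\<close> is congruent to \<open>f\<close>.\<close>
  have *: "z \<cdot> f \<in> ?K"
    if e: "e \<in> idempotents S" and f: "f \<in> idempotents S" and D: "(e, f) \<in> green_D S"
      and z: "z \<in> carrier S" and zK: "z \<cdot> e \<in> ?K" for e f z
  proof -
    have ef [simp]: "e \<in> carrier S" "f \<in> carrier S" using e f by simp_all
    obtain x y where xy: "x \<in> carrier S" "y \<in> carrier S" "f = x \<cdot> e \<cdot> y"
      using D unfolding green_D_iff J_below_def by blast
    have fK: "f \<in> ?K" "e \<in> ?K" using e f by (simp_all add: idempotents_subset_ker)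
    have fe: "(f \<cdot> (e \<cdot> f), \<epsilon> (f \<cdot> (e \<cdot> f))) \<in> \<rho>"
      using orthodox_ker_mul[OF assms(2)] fK mem_ker_iff by blast
    \<comment> \<open>This unit lies below \<open>f\<close> in the natural order and in the same
      D-class, so primitivity applies.\<close>
    have "\<epsilon> (f \<cdot> (e \<cdot> f)) = f"
    proof (rule idempotent_eq_if_J_below)
      show "J_below f (\<epsilon> (f \<cdot> (e \<cdot> f)))"
      proof -
        interpret D: cr_congruence S "green_D S" using congruence_green_D by (rule cr_congruenceI)
        have "(f \<cdot> (e \<cdot> f), f \<cdot> (f \<cdot> f)) \<in> green_D S"
          using D by (intro D.cong_mul_left D.cong_mul_right) auto
        then have "(\<epsilon> (f \<cdot> (e \<cdot> f)), f) \<in> green_D S"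
          using f D.cong_unit by (fastforce simp: idempotent_mul)
        then show ?thesis by (simp add: green_D_iff)
      qed
      show "f \<cdot> \<epsilon> (f \<cdot> (e \<cdot> f)) = \<epsilon> (f \<cdot> (e \<cdot> f))"
        using f by (intro unit_left_fix) (simp_all add: idempotent_mul flip: mul_assoc)
      show "\<epsilon> (f \<cdot> (e \<cdot> f)) \<cdot> f = \<epsilon> (f \<cdot> (e \<cdot> f))"
        using f by (intro unit_right_fix) (simp_all add: idempotent_mul mul_assoc)
    qed (use f in auto)
    then have fef: "(f \<cdot> (e \<cdot> f), f) \<in> \<rho>" using fe by simp
    have "(z \<cdot> e) \<cdot> f \<in> ?K" using zK fK orthodox_ker_mul[OF assms(2)] by blast
    then have "(e \<cdot> f) \<cdot> z \<in> ?K" using swap[of z "e \<cdot> f"] z by (simp add: mul_assoc)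
    then have "f \<cdot> ((e \<cdot> f) \<cdot> z) \<in> ?K" using fK orthodox_ker_mul[OF assms(2)] by blast
    moreover have "(f \<cdot> ((e \<cdot> f) \<cdot> z), f \<cdot> z) \<in> \<rho>"
      using cong_mul_right[OF fef z] z by (simp add: mul_assoc)
    ultimately have "f \<cdot> z \<in> ?K"
      unfolding mem_ker_iff using cong_closed cong_sym cong_trans cong_unit by meson
    then show ?thesis using swap z by simp
  qed
  have "(e, f) \<in> \<tau>"
    if e: "e \<in> idempotents S" and f: "f \<in> idempotents S" and D: "(e, f) \<in> green_D S" for e f
    using *[OF e f D] *[OF f e congruence_sym[OF congruence_green_D D]] e f by (auto simp: \<tau>_def)
  then show "clifford (quotient_semigroup S \<tau>)"
    unfolding clifford_quotient_iff_trace_green_D[OF \<tau>] by (auto simp: trace_def)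
  show "ker S \<tau> \<subseteq> ?K"
  proof
    fix a assume "a \<in> ker S \<tau>"
    then have a: "a \<in> carrier S" "(a, \<epsilon> a) \<in> \<tau>"
      using cr_congruence.mem_ker_iff[OF cr_congruenceI[OF \<tau>]] by auto
    \<comment> \<open>The context \<open>\<epsilon> a\<close> leaves \<open>a\<close> unchanged and
      sends \<open>\<epsilon> a\<close> to an idempotent, hence into \<open>?K\<close>.\<close>
    have "\<epsilon> a \<cdot> a \<in> ?K \<longleftrightarrow> \<epsilon> a \<cdot> \<epsilon> a \<in> ?K" using a unfolding \<tau>_def by blast
    then show "a \<in> ?K" using a idempotents_subset_ker by simp
  qed
qed

lemma ker_least_clifford_congruence:
  "ker S (least_clifford_congruence S) = ker S (least_orthodox_congruence S)" (is "ker S ?n = ker S ?l")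
proof
  have l: "congruence S ?l" "orthodox (quotient_semigroup S ?l)"
    "\<And>\<sigma>. congruence S \<sigma> \<Longrightarrow> orthodox (quotient_semigroup S \<sigma>) \<Longrightarrow> ?l \<subseteq> \<sigma>"
    using is_least_orthodox_congruence by (simp_all add: is_least_congruence_def)
  have n: "congruence S ?n" "clifford (quotient_semigroup S ?n)"
    "\<And>\<sigma>. congruence S \<sigma> \<Longrightarrow> clifford (quotient_semigroup S \<sigma>) \<Longrightarrow> ?n \<subseteq> \<sigma>"
    using is_least_clifford_congruence by (simp_all add: is_least_congruence_def least_clifford_congruence_eq)
  obtain \<tau> where "congruence S \<tau>" "clifford (quotient_semigroup S \<tau>)" "ker S \<tau> \<subseteq> ker S ?l"
    using clifford_congruence_saturating_ker[OF l(1,2)] .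
  with n(3) show "ker S ?n \<subseteq> ker S ?l" unfolding ker_def by blast
  have "?l \<subseteq> ?n"
    using l(3)[OF n(1)] cr_congruence.orthodox_quotient_if_clifford[OF cr_congruenceI[OF n(1)] n(2)] .
  then show "ker S ?l \<subseteq> ker S ?n" unfolding ker_def by blast
qed

text \<open>Any congruence with the kernel of \<lambda> has an orthodox quotient, and \<lambda> has
  the kernel of \<nu>; minimality on either side gives the two inclusions.\<close>

lemma least_orthodox_congruence_eq:
  "least_orthodox_congruence S = ker_lower S (least_clifford_congruence S)" (is "?l = ker_lower S ?n")
proof
  have l: "congruence S ?l" "orthodox (quotient_semigroup S ?l)"
    "\<And>\<sigma>. congruence S \<sigma> \<Longrightarrow> orthodox (quotient_semigroup S \<sigma>) \<Longrightarrow> ?l \<subseteq> \<sigma>"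
    using is_least_orthodox_congruence by (simp_all add: is_least_congruence_def)
  have n: "congruence S ?n"
    using is_least_clifford_congruence by (simp add: is_least_congruence_def least_clifford_congruence_eq)
  have k: "congruence S (ker_lower S ?n)" "ker S (ker_lower S ?n) = ker S ?l"
    "\<And>\<sigma>. congruence S \<sigma> \<Longrightarrow> ker S \<sigma> = ker S ?l \<Longrightarrow> ker_lower S ?n \<subseteq> \<sigma>"
    using ker_lower_is_least[OF n] by (simp_all add: is_least_congruence_def ker_least_clifford_congruence)
  show "ker_lower S ?n \<subseteq> ?l" using k(3) l(1) by blast
  have "orthodox (quotient_semigroup S (ker_lower S ?n))"
    using l(2) k cr_congruence.orthodox_quotient_iff[OF cr_congruenceI] l(1) by metis
  then show "?l \<subseteq> ker_lower S ?n" using l(3) k(1) by blast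
qed

end

section \<open>Cryptogroup kernels\<close>

text \<open>H is equality of units and contains every pair \<open>(a, \<epsilon> a)\<close>;
  compatibility on these pairs already lets units replace factors in general.\<close>

lemma (in cr_semigroup) cryptogroup_iff:
  "cryptogroup S \<longleftrightarrow> (\<forall>a\<in>carrier S. \<forall>b\<in>carrier S. \<epsilon> (a \<cdot> b) = \<epsilon> (\<epsilon> a \<cdot> \<epsilon> b))"
proof
  assume "cryptogroup S"
  then have H: "congruence S (green_H S)" by (simp add: cryptogroup_def)
  have "(a \<cdot> b, \<epsilon> a \<cdot> \<epsilon> b) \<in> green_H S" if "a \<in> carrier S" "b \<in> carrier S" for a b
    using that by (intro congruence_mul[OF H]) (simp_all add: green_H_iff)
  then show "\<forall>a\<in>carrier S. \<forall>b\<in>carrier S. \<epsilon> (a \<cdot> b) = \<epsilon> (\<epsilon> a \<cdot> \<epsilon> b)"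
    unfolding green_H_iff by blast
next
  assume *: "\<forall>a\<in>carrier S. \<forall>b\<in>carrier S. \<epsilon> (a \<cdot> b) = \<epsilon> (\<epsilon> a \<cdot> \<epsilon> b)"
  have "congruence S (green_H S)"
  proof (rule congruenceI)
    fix a b c assume "(a, b) \<in> green_H S" "c \<in> carrier S"
    then show "(c \<cdot> a, c \<cdot> b) \<in> green_H S" "(a \<cdot> c, b \<cdot> c) \<in> green_H S"
      unfolding green_H_iff using * by (metis mul_closed)+
  qed (auto simp: green_H_iff)
  then show "cryptogroup S" by (simp add: cryptogroup_def completely_regular)
qed

context cr_congruence
begin

lemma cr_semigroup_ker:
  assumes "orthodox Q"
  shows "cr_semigroup (ker_semigroup S \<rho>)"
proof unfold_locales
  fix a assume "a \<in> carrier (ker_semigroup S \<rho>)"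
  then have a: "a \<in> carrier S" "(a, \<epsilon> a) \<in> \<rho>" by (simp_all add: ker_semigroup_def mem_ker_iff)
  \<comment> \<open>\<open>\<iota> a\<close> may fall outside the kernel; the group inverse is
    congruent to \<open>a \<cdot> \<iota> a = \<epsilon> a\<close> and stays inside.\<close>
  let ?x = "\<epsilon> a \<cdot> \<iota> a"
  have "(?x, a \<cdot> \<iota> a) \<in> \<rho>" using a by (intro cong_mul_right cong_sym[OF a(2)]) auto
  then have "?x \<in> ker S \<rho>" using a unfolding ker_def by (auto simp: mul_inv)
  then show "\<exists>x\<in>carrier (ker_semigroup S \<rho>). a \<cdot>\<^bsub>ker_semigroup S \<rho>\<^esub> x \<cdot>\<^bsub>ker_semigroup S \<rho>\<^esub> a = a \<and>
      a \<cdot>\<^bsub>ker_semigroup S \<rho>\<^esub> x = x \<cdot>\<^bsub>ker_semigroup S \<rho>\<^esub> a"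
    using a by (intro bexI[of _ ?x]) (simp_all add: ker_semigroup_def mul_assoc mul_inv inv_mul)
qed (use orthodox_ker_mul[OF assms] in
    \<open>simp_all add: ker_semigroup_def mem_ker_iff mul_assoc\<close>)

text \<open>The kernel has its own choice of \<open>\<iota>\<close>, but a commuting inverse inside
  it is also one in \<open>S\<close>, so units agree.\<close>

lemma cryptogroup_ker_iff:
  assumes "orthodox Q"
  shows "cryptogroup (ker_semigroup S \<rho>) \<longleftrightarrow>
    (\<forall>a\<in>ker S \<rho>. \<forall>b\<in>ker S \<rho>. \<epsilon> (a \<cdot> b) = \<epsilon> (\<epsilon> a \<cdot> \<epsilon> b))"
proof -
  let ?K = "ker_semigroup S \<rho>"
  interpret K: cr_semigroup ?K by (rule cr_semigroup_ker[OF assms])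
  have K [simp]: "carrier ?K = ker S \<rho>" "mul ?K = mul S" by (simp_all add: ker_semigroup_def)
  have unit: "\<epsilon>\<^bsub>?K\<^esub> a = \<epsilon> a" if a: "a \<in> ker S \<rho>" for a
  proof -
    have "\<iota>\<^bsub>?K\<^esub> a \<in> ker S \<rho>" using K.inv_closed a by simp
    then have "\<epsilon> a = a \<cdot> \<iota>\<^bsub>?K\<^esub> a"
      using a K.unit_mul[of a] K.mul_inv[of a] K.inv_mul[of a]
      by (intro unit_unique) (simp_all add: mem_ker_iff mul_assoc)
    then show ?thesis using K.mul_inv[of a] a by simp
  qed
  have "\<epsilon> a \<in> ker S \<rho>" if "a \<in> ker S \<rho>" for a
    using that by (simp add: mem_ker_iff)
  then show ?thesis
    using orthodox_ker_mul[OF assms] by (simp add: K.cryptogroup_iff unit)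
qed

end

context cr_semigroup
begin

text \<open>The witness is the largest congruence contained in \<open>\<H>\<close>: over a cryptogroup kernel it
  identifies every \<open>k\<close> in the kernel with its idempotent, so its quotient is orthodox.\<close>

lemma trace_least_orthodox_congruence_trivial:
  assumes "cryptogroup (ker_semigroup S (least_clifford_congruence S))"
    and "(e, f) \<in> least_orthodox_congruence S" "e \<in> idempotents S" "f \<in> idempotents S"
  shows "e = f"
proof -
  let ?n = "least_clifford_congruence S"
  have n: "congruence S ?n" "clifford (quotient_semigroup S ?n)"
    using is_least_clifford_congruence
    by (simp_all add: is_least_congruence_def least_clifford_congruence_eq)
  interpret n: cr_congruence S ?n using n(1) by (rule cr_congruenceI)
  note orth = n.orthodox_quotient_if_clifford[OF n(2)]
  have crypto: "\<epsilon> (a \<cdot> b) = \<epsilon> (\<epsilon> a \<cdot> \<epsilon> b)" if "a \<in> ker S ?n" "b \<in> ker S ?n" for a b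
    using assms(1) that n.cryptogroup_ker_iff[OF orth] by blast
  \<comment> \<open>The conjunct \<open>\<epsilon> a = \<epsilon> b\<close> is the empty context.
    One-sided contexts are recovered by filling the other side with this common unit.\<close>
  define \<mu> where "\<mu> = {(a, b). a \<in> carrier S \<and> b \<in> carrier S \<and> \<epsilon> a = \<epsilon> b \<and>
    (\<forall>x\<in>carrier S. \<forall>y\<in>carrier S. \<epsilon> (x \<cdot> (a \<cdot> y)) = \<epsilon> (x \<cdot> (b \<cdot> y)))}"
  have \<mu>: "congruence S \<mu>"
  proof (rule congruenceI)
    fix a b c assume ab: "(a, b) \<in> \<mu>" and c: "c \<in> carrier S"
    then have [simp]: "a \<in> carrier S" "b \<in> carrier S" and eq: "\<epsilon> a = \<epsilon> b"
      and *: "\<And>x y. x \<in> carrier S \<Longrightarrow> y \<in> carrier S \<Longrightarrow> \<epsilon> (x \<cdot> (a \<cdot> y)) = \<epsilon> (x \<cdot> (b \<cdot> y))"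
      by (auto simp: \<mu>_def)
    have "\<epsilon> (c \<cdot> a) = \<epsilon> (c \<cdot> b)" using *[of c "\<epsilon> a"] c by (simp add: eq) (simp flip: eq)
    moreover have "\<epsilon> (x \<cdot> ((c \<cdot> a) \<cdot> y)) = \<epsilon> (x \<cdot> ((c \<cdot> b) \<cdot> y))"
      if "x \<in> carrier S" "y \<in> carrier S" for x y
      using *[of "x \<cdot> c" y] c that by (simp add: mul_assoc)
    ultimately show "(c \<cdot> a, c \<cdot> b) \<in> \<mu>" using c by (simp add: \<mu>_def)
    have "\<epsilon> a \<cdot> (a \<cdot> c) = a \<cdot> c" "\<epsilon> a \<cdot> (b \<cdot> c) = b \<cdot> c" using c by simp (simp add: eq c)
    then have "\<epsilon> (a \<cdot> c) = \<epsilon> (b \<cdot> c)" using *[of "\<epsilon> a" c] c by simp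
    moreover have "\<epsilon> (x \<cdot> ((a \<cdot> c) \<cdot> y)) = \<epsilon> (x \<cdot> ((b \<cdot> c) \<cdot> y))"
      if "x \<in> carrier S" "y \<in> carrier S" for x y
      using *[of x "c \<cdot> y"] c that by (simp add: mul_assoc)
    ultimately show "(a \<cdot> c, b \<cdot> c) \<in> \<mu>" using c by (simp add: \<mu>_def)
  qed (auto simp: \<mu>_def)
  interpret m: cr_congruence S \<mu> using \<mu> by (rule cr_congruenceI)
  have ker: "k \<in> ker S \<mu>" if k: "k \<in> ker S ?n" for k
  proof -
    have kS [simp]: "k \<in> carrier S" using k by (simp add: n.mem_ker_iff)
    have uK: "\<epsilon> y \<in> ker S ?n" if "y \<in> carrier S" for y
      using that n.idempotents_subset_ker by simp
    \<comment> \<open>\<open>crypto\<close> covers kernel elements only, but \<open>y\<close> is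
      arbitrary. As \<open>y\<close> and \<open>\<epsilon> y\<close> are R-related and R is
      compatible on the left, \<open>y\<close> can be traded for the kernel element
      \<open>\<epsilon> y\<close> when only R-classes are compared. L treats the left factor, and
      both together give H.\<close>
    have R: "(k \<cdot> y, \<epsilon> k \<cdot> y) \<in> green_R S" if y: "y \<in> carrier S" for y
    proof -
      have 1: "(k \<cdot> y, k \<cdot> \<epsilon> y) \<in> green_R S" "(\<epsilon> k \<cdot> y, \<epsilon> k \<cdot> \<epsilon> y) \<in> green_R S"
        using y green_R_mul_left[OF green_R_unit[OF y]] by auto
      have "\<epsilon> (k \<cdot> \<epsilon> y) = \<epsilon> (\<epsilon> k \<cdot> \<epsilon> y)" using crypto[OF k uK[OF y]] y by simp
      then have "(k \<cdot> \<epsilon> y, \<epsilon> k \<cdot> \<epsilon> y) \<in> green_H S" using y by (simp add: green_H_iff)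
      then have "(k \<cdot> \<epsilon> y, \<epsilon> k \<cdot> \<epsilon> y) \<in> green_R S" by (simp add: green_H_def)
      then show ?thesis using 1 green_R_sym green_R_trans by meson
    qed
    have L: "(x \<cdot> k, x \<cdot> \<epsilon> k) \<in> green_L S" if x: "x \<in> carrier S" for x
    proof -
      have 1: "(x \<cdot> k, \<epsilon> x \<cdot> k) \<in> green_L S" "(x \<cdot> \<epsilon> k, \<epsilon> x \<cdot> \<epsilon> k) \<in> green_L S"
        using x green_L_mul_right[OF green_L_unit[OF x]] by auto
      have "\<epsilon> (\<epsilon> x \<cdot> k) = \<epsilon> (\<epsilon> x \<cdot> \<epsilon> k)" using crypto[OF uK[OF x] k] x by simp
      then have "(\<epsilon> x \<cdot> k, \<epsilon> x \<cdot> \<epsilon> k) \<in> green_H S" using x by (simp add: green_H_iff)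
      then have "(\<epsilon> x \<cdot> k, \<epsilon> x \<cdot> \<epsilon> k) \<in> green_L S" by (simp add: green_H_def)
      then show ?thesis using 1 green_L_sym green_L_trans by meson
    qed
    have "\<epsilon> (x \<cdot> (k \<cdot> y)) = \<epsilon> (x \<cdot> (\<epsilon> k \<cdot> y))" if "x \<in> carrier S" "y \<in> carrier S" for x y
    proof -
      have "(x \<cdot> (k \<cdot> y), x \<cdot> (\<epsilon> k \<cdot> y)) \<in> green_R S" using R green_R_mul_left that by blast
      moreover have "(x \<cdot> (k \<cdot> y), x \<cdot> (\<epsilon> k \<cdot> y)) \<in> green_L S"
        using green_L_mul_right[OF L, of x y] that by (simp add: mul_assoc)
      ultimately have "(x \<cdot> (k \<cdot> y), x \<cdot> (\<epsilon> k \<cdot> y)) \<in> green_H S" by (simp add: green_H_def)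
      then show ?thesis by (simp add: green_H_iff)
    qed
    then have "(k, \<epsilon> k) \<in> \<mu>" by (simp add: \<mu>_def)
    then show ?thesis by (simp add: m.mem_ker_iff)
  qed
  then have "orthodox (quotient_semigroup S \<mu>)"
    using orth m.orthodox_quotient_iff n.orthodox_quotient_iff by blast
  then have "least_orthodox_congruence S \<subseteq> \<mu>"
    using is_least_orthodox_congruence \<mu> unfolding is_least_congruence_def by blast
  then have "(e, f) \<in> \<mu>" using assms(2) by blast
  then have "\<epsilon> e = \<epsilon> f" by (simp add: \<mu>_def)
  then show ?thesis using assms(3,4) by simp
qed

end

section \<open>Transfer between a semigroup and its quotients\<close>

context cr_congruence
begin

text \<open>The pullback \<open>\<sigma>\<close> of \<lambda> on \<open>Q\<close> has an orthodox
  quotient and so contains \<lambda> on \<open>S\<close>. Idempotent pairs in \<lambda> therefore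
  map into the trace of \<lambda> on \<open>Q\<close>, which is trivial.\<close>

lemma cong_if_least_orthodox_congruence:
  assumes "cryptogroup (ker_semigroup Q (least_clifford_congruence Q))"
    and "(e, f) \<in> least_orthodox_congruence S" "e \<in> idempotents S" "f \<in> idempotents S"
  shows "(e, f) \<in> \<rho>"
proof -
  interpret Q: cr_semigroup Q by (rule cr_semigroup_quotient)
  let ?l = "least_orthodox_congruence Q"
  have l: "congruence Q ?l" "orthodox (quotient_semigroup Q ?l)"
    using Q.is_least_orthodox_congruence by (simp_all add: is_least_congruence_def)
  interpret l: cr_congruence Q ?l using l(1) by (rule Q.cr_congruenceI)
  define \<sigma> where "\<sigma> = {(a, b). a \<in> carrier S \<and> b \<in> carrier S \<and> (cls a, cls b) \<in> ?l}"
  have \<sigma>: "congruence S \<sigma>"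
  proof (rule congruenceI)
    fix a b c assume "(a, b) \<in> \<sigma>" and c: "c \<in> carrier S"
    then have ab: "a \<in> carrier S" "b \<in> carrier S" "(cls a, cls b) \<in> ?l" by (simp_all add: \<sigma>_def)
    show "(c \<cdot> a, c \<cdot> b) \<in> \<sigma>" "(a \<cdot> c, b \<cdot> c) \<in> \<sigma>"
      using ab c l.cong_mul_left[OF ab(3), of "cls c"] l.cong_mul_right[OF ab(3), of "cls c"]
      by (simp_all add: \<sigma>_def cls_mul)
  qed (auto simp: \<sigma>_def intro: l.cong_sym l.cong_trans)
  interpret s: cr_congruence S \<sigma> using \<sigma> by (rule cr_congruenceI)
  have "a \<cdot> b \<in> ker S \<sigma>" if "a \<in> idempotents S" "b \<in> idempotents S" for a b
  proof -
    have "cls a \<cdot>\<^bsub>Q\<^esub> cls b \<in> ker Q ?l"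
      using l(2) that l.orthodox_quotient_iff idempotents_quotient by simp
    then have "(cls (a \<cdot> b), cls (\<epsilon> (a \<cdot> b))) \<in> ?l"
      using that by (simp add: l.mem_ker_iff cls_mul unit_cls)
    then have "(a \<cdot> b, \<epsilon> (a \<cdot> b)) \<in> \<sigma>" using that by (simp add: \<sigma>_def)
    then show ?thesis using that by (simp add: s.mem_ker_iff)
  qed
  then have "orthodox (quotient_semigroup S \<sigma>)" by (simp add: s.orthodox_quotient_iff)
  then have "least_orthodox_congruence S \<subseteq> \<sigma>"
    using is_least_orthodox_congruence \<sigma> unfolding is_least_congruence_def by blast
  then have "(cls e, cls f) \<in> ?l" using assms(2) by (auto simp: \<sigma>_def)
  then have "cls e = cls f"
    using Q.trace_least_orthodox_congruence_trivial[OF assms(1)] assms(3,4) idempotents_quotient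
    by blast
  then show ?thesis using cls_eq_iff assms(3,4) by simp
qed

text \<open>The image of \<open>\<tau>\<close> on \<open>Q\<close> has a Clifford quotient and so
  contains \<nu> on \<open>Q\<close>. Applied to \<nu> itself, this supplies kernel representatives
  in \<open>S\<close>.\<close>

lemma mem_ker_if_cls_mem_ker_least_clifford:
  assumes "congruence S \<tau>" "clifford (quotient_semigroup S \<tau>)" "\<rho> \<subseteq> \<tau>"
    and "a \<in> carrier S" "cls a \<in> ker Q (least_clifford_congruence Q)"
  shows "a \<in> ker S \<tau>"
proof -
  interpret Q: cr_semigroup Q by (rule cr_semigroup_quotient)
  interpret t: cr_congruence S \<tau> using assms(1) by (rule cr_congruenceI)
  let ?n = "least_clifford_congruence Q"
  have n: "is_least_congruence Q (\<lambda>\<sigma>. clifford (quotient_semigroup Q \<sigma>)) ?n"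
    using Q.is_least_clifford_congruence by (simp add: Q.least_clifford_congruence_eq)
  then interpret n: cr_congruence Q ?n
    by (intro Q.cr_congruenceI) (simp add: is_least_congruence_def)
  define \<sigma> where "\<sigma> = {(cls a, cls b) |a b. (a, b) \<in> \<tau>}"
  \<comment> \<open>\<open>\<rho> \<subseteq> \<tau>\<close> makes membership independent of the
    representatives.\<close>
  have iff: "(cls a, cls b) \<in> \<sigma> \<longleftrightarrow> (a, b) \<in> \<tau>" if "a \<in> carrier S" "b \<in> carrier S" for a b
  proof
    assume "(cls a, cls b) \<in> \<sigma>"
    then obtain c d where cd: "cls a = cls c" "cls b = cls d" "(c, d) \<in> \<tau>"
      unfolding \<sigma>_def by blast
    then have "(a, c) \<in> \<tau>" "(d, b) \<in> \<tau>"
      using that assms(3) cls_eq_iff t.cong_closed[OF cd(3)] cong_sym by blast+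
    then show "(a, b) \<in> \<tau>" using cd(3) t.cong_trans by blast
  qed (auto simp: \<sigma>_def)
  have \<sigma>: "congruence Q \<sigma>"
  proof (rule congruenceI)
    show sub: "\<sigma> \<subseteq> carrier Q \<times> carrier Q"
      using t.cong_closed by (fastforce simp: \<sigma>_def)
    fix A B C
    {
      assume A: "A \<in> carrier Q"
      then show "(A, A) \<in> \<sigma>" using iff by (auto elim!: cls_cases)
    }
    assume AB: "(A, B) \<in> \<sigma>"
    then have "A \<in> carrier Q" "B \<in> carrier Q" using sub by auto
    then obtain a b where ab: "a \<in> carrier S" "b \<in> carrier S" "A = cls a" "B = cls b"
      by (meson cls_cases)
    then have abt: "(a, b) \<in> \<tau>" using AB iff by simp
    then show "(B, A) \<in> \<sigma>" using ab iff t.cong_sym by simp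
    {
      assume BC: "(B, C) \<in> \<sigma>"
      then have "C \<in> carrier Q" using sub by auto
      then obtain c where c: "c \<in> carrier S" "C = cls c" by (rule cls_cases)
      then have "(b, c) \<in> \<tau>" using BC ab iff by simp
      then show "(A, C) \<in> \<sigma>" using abt ab c iff t.cong_trans by blast
    }
    assume "C \<in> carrier Q"
    then obtain c where c: "c \<in> carrier S" "C = cls c" by (rule cls_cases)
    then show "(C \<cdot>\<^bsub>Q\<^esub> A, C \<cdot>\<^bsub>Q\<^esub> B) \<in> \<sigma>" "(A \<cdot>\<^bsub>Q\<^esub> C, B \<cdot>\<^bsub>Q\<^esub> C) \<in> \<sigma>"
      using ab abt iff t.cong_mul_left t.cong_mul_right by (simp_all add: cls_mul)
  qed
  interpret s: cr_congruence Q \<sigma> using \<sigma> by (rule Q.cr_congruenceI)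
  have "clifford (quotient_semigroup Q \<sigma>)"
    using assms(2) iff
    by (simp add: s.clifford_quotient_iff t.clifford_quotient_iff idempotents_quotient
        carrier_quotient cls_mul)
  then have "?n \<subseteq> \<sigma>" using n \<sigma> unfolding is_least_congruence_def by blast
  moreover have "(cls a, cls (\<epsilon> a)) \<in> ?n"
    using assms(4,5) by (simp add: n.mem_ker_iff unit_cls)
  ultimately have "(a, \<epsilon> a) \<in> \<tau>" using iff assms(4) by blast
  then show ?thesis using assms(4) by (simp add: t.mem_ker_iff)
qed

end

lemma (in cr_semigroup) is_least_cryptogroup_congruence:
  "is_least_congruence S
    (\<lambda>\<rho>. let T = quotient_semigroup S \<rho>
         in cryptogroup (ker_semigroup T (least_clifford_congruence T)))
    (trace_lower S (least_orthodox_congruence S))"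
proof -
  let ?l = "least_orthodox_congruence S" and ?n = "least_clifford_congruence S"
  let ?t = "trace_lower S ?l"
  have l: "congruence S ?l" "orthodox (quotient_semigroup S ?l)"
    "\<And>\<sigma>. congruence S \<sigma> \<Longrightarrow> orthodox (quotient_semigroup S \<sigma>) \<Longrightarrow> ?l \<subseteq> \<sigma>"
    using is_least_orthodox_congruence by (simp_all add: is_least_congruence_def)
  have n: "congruence S ?n" "clifford (quotient_semigroup S ?n)"
    using is_least_clifford_congruence
    by (simp_all add: is_least_congruence_def least_clifford_congruence_eq)
  have t: "congruence S ?t" "trace S ?t = trace S ?l"
    using trace_lower_is_least[OF l(1)] by (simp_all add: is_least_congruence_def)
  interpret l: cr_congruence S ?l using l(1) by (rule cr_congruenceI)
  interpret n: cr_congruence S ?n using n(1) by (rule cr_congruenceI)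
  interpret t: cr_congruence S ?t using t(1) by (rule cr_congruenceI)
  \<comment> \<open>The resulting inclusion of \<lambda>_t in \<nu> is what allows \<nu> to be
    pushed down to \<open>?Q\<close>.\<close>
  have "?l \<subseteq> ?n" using l(3) n(1) n.orthodox_quotient_if_clifford[OF n(2)] by blast
  moreover have "?t \<subseteq> ?l"
    using trace_lower_subset[OF l(1) l(1)] by (simp add: trace_def)
  ultimately have "?t \<subseteq> ?n" by blast
  let ?Q = "quotient_semigroup S ?t"
  let ?nQ = "least_clifford_congruence ?Q"
  interpret Q: cr_semigroup ?Q by (rule t.cr_semigroup_quotient)
  have nQ: "congruence ?Q ?nQ" "clifford (quotient_semigroup ?Q ?nQ)"
    using Q.is_least_clifford_congruence
    by (simp_all add: is_least_congruence_def Q.least_clifford_congruence_eq)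
  interpret nQ: cr_congruence ?Q ?nQ using nQ(1) by (rule Q.cr_congruenceI)
  have lifts: "\<exists>a\<in>ker S ?l. A = t.cls a" if "A \<in> ker ?Q ?nQ" for A
  proof -
    have "A \<in> carrier ?Q" using that by (simp add: nQ.mem_ker_iff)
    then obtain a where a: "a \<in> carrier S" "A = t.cls a" by (rule t.cls_cases)
    then have "a \<in> ker S ?n"
      using t.mem_ker_if_cls_mem_ker_least_clifford[OF n \<open>?t \<subseteq> ?n\<close>] that by simp
    then show ?thesis using a by (auto simp: ker_least_clifford_congruence)
  qed
  have "\<epsilon>\<^bsub>?Q\<^esub> (A \<cdot>\<^bsub>?Q\<^esub> B) = \<epsilon>\<^bsub>?Q\<^esub> (\<epsilon>\<^bsub>?Q\<^esub> A \<cdot>\<^bsub>?Q\<^esub> \<epsilon>\<^bsub>?Q\<^esub> B)"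
    if A: "A \<in> ker ?Q ?nQ" and B: "B \<in> ker ?Q ?nQ" for A B
  proof -
    obtain a b where ab: "a \<in> carrier S" "b \<in> carrier S" "(a, \<epsilon> a) \<in> ?l" "(b, \<epsilon> b) \<in> ?l"
      "A = t.cls a" "B = t.cls b"
      using lifts[OF A] lifts[OF B] by (auto simp: l.mem_ker_iff)
    \<comment> \<open>Both entries are idempotents, so the pair lies in the trace shared by
      \<lambda> and \<lambda>_t and becomes an equality in \<open>?Q\<close>.\<close>
    have "(\<epsilon> (a \<cdot> b), \<epsilon> (\<epsilon> a \<cdot> \<epsilon> b)) \<in> ?l"
      by (rule l.cong_unit[OF l.cong_mul[OF ab(3,4)]])
    then have "(\<epsilon> (a \<cdot> b), \<epsilon> (\<epsilon> a \<cdot> \<epsilon> b)) \<in> trace S ?t"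
      using ab by (simp add: t(2)) (simp add: trace_def)
    then show ?thesis using ab
      by (simp add: t.cls_mul t.unit_cls t.cls_eq_iff trace_def)
  qed
  then have "cryptogroup (ker_semigroup ?Q ?nQ)"
    unfolding nQ.cryptogroup_ker_iff[OF nQ.orthodox_quotient_if_clifford[OF nQ(2)]] by blast
  moreover have "?t \<subseteq> \<rho>"
    if \<rho>: "congruence S \<rho>"
      and "cryptogroup (ker_semigroup (quotient_semigroup S \<rho>)
        (least_clifford_congruence (quotient_semigroup S \<rho>)))" for \<rho>
    using cr_congruence.cong_if_least_orthodox_congruence[OF cr_congruenceI[OF \<rho>] that(2)]
    by (intro trace_lower_subset[OF l(1) \<rho>]) (auto simp: trace_def)
  ultimately show ?thesis using t(1) by (simp add: is_least_congruence_def Let_def)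
qed

theorem corollary2p11:
  fixes S :: "'a magma"
  assumes "completely_regular S"
  shows "trace_lower S (least_orthodox_congruence S)
       = trace_lower S (ker_lower S (trace_lower S (green_D S)))
    \<and> is_least_congruence S
        (\<lambda>\<rho>. let T = quotient_semigroup S \<rho>
             in cryptogroup (ker_semigroup T (least_clifford_congruence T)))
        (trace_lower S (least_orthodox_congruence S))"
proof -
  interpret cr_semigroup S using assms by (simp add: completely_regular_iff_cr_semigroup)
  show ?thesis
    using is_least_cryptogroup_congruence least_orthodox_congruence_eq
    by (simp add: least_clifford_congruence_eq)
qed

end
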